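(* Let $\mathbb{G}$ be a homogeneous group of homogeneous dimension $Q$ with a homogeneous quasi-norm $|\cdot|$. Let $\phi_3,\phi_4,\psi_3,\psi_4$ be positive functions on $\mathbb{G}$, and let $1<q<p<\infty$ with $1/\delta=1/q-1/p$. Let $1/p+1/p'=1$ and $1/q+1/q'=1$. Then the inequality $$\left(\int_{\mathbb{G}}\left(\int_{B(0,|x|)}f(z)\,dz\right)^{q}\phi_{3}(x)\,dx\right)^{1/q}\le C_{1}\left(\int_{\mathbb{G}}(f(x))^{p}\psi_{3}(x)\,dx\right)^{1/p}$$ holds (for some finite constant $C_1$) for all $f\ge0$ if and only if $$A_{3}:=\int_{\mathbb{G}}\left(\int_{\mathbb{G}\setminus B(0,|x|)}\phi_{3}(z)\,dz\right)^{\delta/q}\left(\int_{B(0,|x|)}(\psi_{3}(z))^{1-p'}dz\right)^{\delta/q'}(\psi_{3}(x))^{1-p'}dx<\infty,$$ and the inequality $$\left(\int_{\mathbb{G}}\left(\int_{\mathbb{G}\setminus B(0,|x|)}f(z)\,dz\right)^{q}\phi_{4}(x)\,dx\right)^{1/q}\le C_{2}\left(\int_{\mathbb{G}}(f(x))^{p}\psi_{4}(x)\,dx\right)^{1/p}$$ holds (for some finite constant $C_2$) for all $f\ge0$ if and only if $$A_{4}:=\int_{\mathbb{G}}\left(\int_{B(0,|x|)}\phi_{4}(z)\,dz\right)^{\delta/q}\left(\int_{\mathbb{G}\setminus B(0,|x|)}(\psi_{4}(z))^{1-p'}dz\right)^{\delta/q'}(\psi_{4}(x))^{1-p'}dx<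\infty.$$
   Context: A homogeneous group $\mathbb{G}$ is a connected simply connected Lie group whose Lie algebra $\mathfrak g$ is equipped with a family of dilations $D_\lambda=\mathrm{Exp}(A\ln\lambda)$, $\lambda>0$, where $A$ is a diagonalisable linear operator on $\mathfrak g$ with positive eigenvalues and each $D_\lambda$ is a Lie algebra morphism. Through the exponential map, $\mathbb G$ is identified with $\mathbb R^n$ (identity element $0$), the dilations act on $\mathbb G$ (written $x\mapsto\lambda x$), and Lebesgue measure $dx$ is a Haar measure. The homogeneous dimension is $Q=\mathrm{Tr}\,A$. A homogeneous quasi-norm is a continuous function $|\cdot|:\mathbb G\to[0,\infty)$ with $|x^{-1}|=|x|$, $|\lambda x|=\lambda|x|$ for $\lambda>0$, and $|x|=0$ iff $x=0$. Quasi-balls: $B(x,R)=\{y\in\mathbb G:|x^{-1}y|<R\}$; in particular $B(0,|x|)=\{z:|z|<|x|\}$. All functions are measurable. *)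

theory Defs
  imports "HOL-Analysis.Analysis"
begin

section \<open>Smooth maps\<close>

primrec C_times :: "nat \<Rightarrow> ('a::real_normed_vector \<Rightarrow> 'b::real_normed_vector) \<Rightarrow> bool" where
  "C_times 0 f \<longleftrightarrow> continuous_on UNIV f"
| "C_times (Suc k) f \<longleftrightarrow>
     (\<forall>x. f differentiable (at x)) \<and> (\<forall>v. C_times k (\<lambda>x. frechet_derivative f (at x) v))"

definition smooth_map :: "('a::real_normed_vector \<Rightarrow> 'b::real_normed_vector) \<Rightarrow> bool" where
  "smooth_map f \<longleftrightarrow> (\<forall>k. C_times k f)"

section \<open>Linear algebra\<close>

definition diagonalisable :: "('a::real_vector \<Rightarrow> 'a) \<Rightarrow> bool" where
  "diagonalisable A \<longleftrightarrow>
     (\<exists>B. independent B \<and> span B = UNIV \<and> (\<forall>b\<in>B. \<exists>\<mu>. A b = \<mu> *\<^sub>R b))"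

definition eigenvalue :: "('a::real_vector \<Rightarrow> 'a) \<Rightarrow> real \<Rightarrow> bool" where
  "eigenvalue A \<mu> \<longleftrightarrow> (\<exists>v. v \<noteq> 0 \<and> A v = \<mu> *\<^sub>R v)"

definition op_exp :: "('a::real_normed_vector \<Rightarrow> 'a) \<Rightarrow> 'a \<Rightarrow> 'a" where
  "op_exp T x = (\<Sum>k. (T ^^ k) x /\<^sub>R fact k)"

section \<open>Homogeneous groups\<close>

text \<open>
  The positive dilations force the Lie algebra to be nilpotent, so for a connected simply
  connected group the exponential map is a global diffeomorphism. A homogeneous group is
  therefore presented in exponential coordinates: both the group and its Lie
  algebra (the tangent space at the identity 0) are the vector space \<open>real^'n\<close>, and the
  exponential map is the identity, that is, the one-parameter subgroup with initial velocity
  \<open>x\<close> is \<open>t \<mapsto> t *\<^sub>R x\<close>. The Lie bracket is the differential of the adjoint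
  representation, \<open>[x, y] = d/ds Ad(exp(s x)) y\<close> at \<open>s = 0\<close>.
\<close>

definition adjoint_rep ::
  "('a::real_normed_vector \<Rightarrow> 'a \<Rightarrow> 'a) \<Rightarrow> ('a \<Rightarrow> 'a) \<Rightarrow> 'a \<Rightarrow> 'a \<Rightarrow> 'a" where
  "adjoint_rep mul iv g y = vector_derivative (\<lambda>t. mul (mul g (t *\<^sub>R y)) (iv g)) (at 0)"

definition lie_bracket ::
  "('a::real_normed_vector \<Rightarrow> 'a \<Rightarrow> 'a) \<Rightarrow> ('a \<Rightarrow> 'a) \<Rightarrow> 'a \<Rightarrow> 'a \<Rightarrow> 'a" where
  "lie_bracket mul iv x y = vector_derivative (\<lambda>s. adjoint_rep mul iv (s *\<^sub>R x) y) (at 0)"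

definition lie_algebra_morphism :: "('a::real_vector \<Rightarrow> 'a \<Rightarrow> 'a) \<Rightarrow> ('a \<Rightarrow> 'a) \<Rightarrow> bool" where
  "lie_algebra_morphism br h \<longleftrightarrow> linear h \<and> (\<forall>x y. h (br x y) = br (h x) (h y))"

definition dilation :: "('a::real_normed_vector \<Rightarrow> 'a) \<Rightarrow> real \<Rightarrow> 'a \<Rightarrow> 'a" where
  "dilation A r = op_exp (\<lambda>x. ln r *\<^sub>R A x)"

locale homogeneous_group = group mul 0 iv
  for mul :: "real^'n \<Rightarrow> real^'n \<Rightarrow> real^'n" and iv :: "real^'n \<Rightarrow> real^'n" +
  fixes A :: "real^'n \<Rightarrow> real^'n"
  assumes smooth_mul: "smooth_map (\<lambda>(x, y). mul x y)"
    and smooth_iv: "smooth_map iv"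
    and exp_coordinates: "mul (s *\<^sub>R x) (t *\<^sub>R x) = (s + t) *\<^sub>R x"
    and linear_A: "linear A"
    and diagonalisable_A: "diagonalisable A"
    and eigenvalue_pos: "eigenvalue A \<mu> \<Longrightarrow> 0 < \<mu>"
    and dilation_morphism: "0 < r \<Longrightarrow> lie_algebra_morphism (lie_bracket mul iv) (dilation A r)"

definition homogeneous_dim :: "(real^'n \<Rightarrow> real^'n) \<Rightarrow> real" where
  "homogeneous_dim A = trace (matrix A)"

definition homogeneous_quasi_norm ::
  "(real^'n \<Rightarrow> real^'n) \<Rightarrow> (real^'n \<Rightarrow> real^'n) \<Rightarrow> (real^'n \<Rightarrow> real) \<Rightarrow> bool" where
  "homogeneous_quasi_norm iv A N \<longleftrightarrow>
     continuous_on UNIV N \<and> (\<forall>x. 0 \<le> N x) \<and> (\<forall>x. N (iv x) = N x) \<and>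
     (\<forall>r x. 0 < r \<longrightarrow> N (dilation A r x) = r * N x) \<and> (\<forall>x. N x = 0 \<longleftrightarrow> x = 0)"

definition quasi_ball ::
  "(real^'n \<Rightarrow> real^'n \<Rightarrow> real^'n) \<Rightarrow> (real^'n \<Rightarrow> real^'n) \<Rightarrow> (real^'n \<Rightarrow> real) \<Rightarrow>
   real^'n \<Rightarrow> real \<Rightarrow> (real^'n) set" where
  "quasi_ball mul iv N x R = {y. N (mul (iv x) y) < R}"

section \<open>Powers of extended nonnegative reals\<close>

text \<open>Intended for positive exponents, where \<open>\<infinity> epowr a = \<infinity>\<close> and \<open>0 epowr a = 0\<close>.\<close>

definition epowr :: "ennreal \<Rightarrow> real \<Rightarrow> ennreal" (infixr \<open>epowr\<close> 80) where
  "x epowr a = (if x = \<infinity> then \<infinity> else ennreal (enn2real x powr a))"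

end

theory Submission
  imports Defs
begin

text \<open>
  Only the ordering of points by \<open>N\<close> matters, so the two inequalities are the same statement
  for \<open>N\<close> and \<open>- N\<close>, once the spheres are known to be null. Put \<open>\<sigma> = \<psi>\<^sup>1\<^sup>-\<^sup>p\<^sup>'\<close>, \<open>f = g \<sigma>\<close>,
  \<open>F x = \<integral>\<^bsub>N z < N x\<^esub> g \<sigma>\<close>, \<open>S x = \<integral>\<^bsub>N z < N x\<^esub> \<sigma>\<close> and \<open>G x = \<integral>\<^bsub>N z > N x\<^esub> \<phi>\<close>.
  Instead of integrating by parts one uses \<open>F\<^sup>q \<le> 4\<^sup>q \<integral>\<^bsub>N z < N x\<^esub> F\<^sup>q\<^sup>-\<^sup>1 g \<sigma>\<close>, which holds because
  \<open>F\<close> exceeds \<open>F x / 4\<close> on at least half of the mass below \<open>x\<close>. By Fubini it gives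
  \<open>\<integral> F\<^sup>q \<phi> \<le> 4\<^sup>q \<integral> (F / S)\<^sup>q\<^sup>-\<^sup>1 g (S\<^sup>q\<^sup>-\<^sup>1 G) \<sigma>\<close>, and Hoelder's inequality with exponents
  \<open>p/(q-1)\<close>, \<open>p\<close>, \<open>p/(p-q)\<close> together with the boundedness of \<open>g \<mapsto> F / S\<close> on \<open>L\<^sup>p(\<sigma>)\<close> proves
  sufficiency. For necessity, testing with a product of powers of \<open>G\<close> and \<open>S\<close> yields
  \<open>A \<le> K A\<^sup>q\<^sup>/\<^sup>p\<close>, which bounds \<open>A\<close> when it is finite; truncating the weights makes it finite
  without affecting \<open>K\<close>.
\<close>

section \<open>Powers of extended nonnegative reals\<close>

lemma epowr_top [simp]: "top epowr a = top"
  by (simp add: epowr_def)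

lemma epowr_ennreal: "0 \<le> x \<Longrightarrow> ennreal x epowr a = ennreal (x powr a)"
  by (simp add: epowr_def)

lemma epowr_zero [simp]: "0 epowr a = 0"
  by (simp add: epowr_def)

lemma epowr_by_one [simp]: "x epowr 1 = x"
  by (cases x) (auto simp: epowr_def)

lemma epowr_eq_top_iff [simp]: "x epowr a = top \<longleftrightarrow> x = top"
  by (simp add: epowr_def)

lemma epowr_less_top_iff [simp]: "x epowr a < top \<longleftrightarrow> x < top"
  by (simp flip: less_top)

lemma epowr_eq_0_iff [simp]: "x epowr a = 0 \<longleftrightarrow> x = 0"
  by (cases x) (auto simp: epowr_def)

text \<open>Exponents of both signs occur later. The law survives at 0 and \<open>top\<close>
  because every power fixes these two points; in particular \<open>0 epowr 0 = 0\<close>, so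
  opposite powers cancel to 1 only for a nonzero finite base.\<close>

lemma epowr_add: "x epowr (a + b) = x epowr a * x epowr b"
  by (cases x) (auto simp: epowr_def powr_add ennreal_mult ennreal_top_mult)

lemma epowr_epowr: "(x epowr a) epowr b = x epowr (a * b)"
  by (cases x) (auto simp: epowr_def powr_powr)

lemma epowr_mult: "(x * y) epowr a = x epowr a * y epowr a"
proof (cases "x = top \<or> y = top")
  case True
  show ?thesis
  proof (cases "x = 0 \<or> y = 0")
    case False
    with True show ?thesis
      by (auto simp: ennreal_mult_top ennreal_top_mult)
  qed auto
next
  case False
  then show ?thesis
    by (cases x; cases y)
      (auto simp: epowr_ennreal powr_mult ennreal_mult simp flip: ennreal_mult)
qed

lemma epowr_mono: "x \<le> y \<Longrightarrow> 0 \<le> a \<Longrightarrow> x epowr a \<le> y epowr a"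
  by (cases x; cases y) (auto simp: epowr_def top_unique intro!: ennreal_leI powr_mono2)

text \<open>For a > 0 the power is an order isomorphism of the extended nonnegative reals with
  inverse the power 1 / a, and such maps preserve suprema.\<close>

lemma epowr_SUP:
  assumes "0 < a"
  shows "(SUP i\<in>I. f i) epowr a = (SUP i\<in>I. f i epowr a)"
proof (rule antisym)
  let ?U = "SUP i\<in>I. f i epowr a"
  have "(SUP i\<in>I. f i) \<le> ?U epowr (1 / a)"
  proof (rule SUP_least)
    fix i assume "i \<in> I"
    then have "(f i epowr a) epowr (1 / a) \<le> ?U epowr (1 / a)"
      using assms by (intro epowr_mono SUP_upper) auto
    then show "f i \<le> ?U epowr (1 / a)"
      using assms by (simp add: epowr_epowr)
  qed
  then have "(SUP i\<in>I. f i) epowr a \<le> (?U epowr (1 / a)) epowr a"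
    using assms by (intro epowr_mono) auto
  then show "(SUP i\<in>I. f i) epowr a \<le> ?U"
    using assms by (simp add: epowr_epowr)
  show "?U \<le> (SUP i\<in>I. f i) epowr a"
    using assms by (intro SUP_least epowr_mono SUP_upper) auto
qed

lemma borel_measurable_epowr [measurable (raw)]:
  assumes [measurable]: "f \<in> borel_measurable M"
  shows "(\<lambda>x. f x epowr a) \<in> borel_measurable M"
  unfolding epowr_def by measurable

text \<open>After division by the two integrals the claim is the weighted Young inequality under the
  integral sign. An integral equal to 0 makes the left integrand vanish almost everywhere; otherwise
  an infinite one makes the right side infinite.\<close>

lemma Holder_nn_integral:
  assumes [measurable]: "u \<in> borel_measurable M" "v \<in> borel_measurable M"
    and a: "0 < a" and b: "0 < b" and ab: "a + b = 1"
  shows "(\<integral>\<^sup>+x. u x epowr a * v x epowr b \<partial>M)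
    \<le> (\<integral>\<^sup>+x. u x \<partial>M) epowr a * (\<integral>\<^sup>+x. v x \<partial>M) epowr b"
proof -
  let ?U = "\<integral>\<^sup>+x. u x \<partial>M" and ?V = "\<integral>\<^sup>+x. v x \<partial>M"
  consider "?U = 0 \<or> ?V = 0" | "?U \<noteq> 0" "?V \<noteq> 0" "?U = \<infinity> \<or> ?V = \<infinity>"
    | "?U \<noteq> 0" "?V \<noteq> 0" "?U \<noteq> \<infinity>" "?V \<noteq> \<infinity>" by blast
  then show ?thesis
  proof cases
    case 1
    then have "(AE x in M. u x = 0) \<or> (AE x in M. v x = 0)"
      by (simp add: nn_integral_0_iff_AE)
    then have "AE x in M. u x epowr a * v x epowr b = 0"
      by auto
    then have "(\<integral>\<^sup>+x. u x epowr a * v x epowr b \<partial>M) = 0"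
      by (subst nn_integral_0_iff_AE) auto
    then show ?thesis by simp
  next
    case 2
    have "?U epowr a * ?V epowr b = \<infinity>"
      using 2 by (auto simp: ennreal_mult_top ennreal_top_mult)
    then show ?thesis by simp
  next
    case 3
    obtain U where U: "?U = ennreal U" "0 < U"
      using 3 by (cases ?U) (auto simp: ennreal_eq_0_iff not_le)
    obtain V where V: "?V = ennreal V" "0 < V"
      using 3 by (cases ?V) (auto simp: ennreal_eq_0_iff not_le)
    have young: "s epowr a * t epowr b \<le> ennreal a * s + ennreal b * t" for s t
    proof (cases s; cases t)
      fix s' t' assume st: "s = ennreal s'" "0 \<le> s'" "t = ennreal t'" "0 \<le> t'"
      have "s' powr a * t' powr b \<le> a * s' + b * t'"
        using Youngs_inequality_0[of a b s' t'] a b ab st by (cases "s' = 0 \<or> t' = 0") auto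
      then show ?thesis
        using st a b by (auto simp: epowr_ennreal simp flip: ennreal_mult ennreal_plus
            intro!: ennreal_leI)
    qed (use a b in \<open>auto simp: ennreal_mult_top\<close>)
    have scale: "u x epowr a * v x epowr b
      = ennreal (U powr a * V powr b) *
        ((ennreal (1/U) * u x) epowr a * (ennreal (1/V) * v x) epowr b)" for x
    proof -
      have "U powr a * V powr b * ((1/U) powr a * (1/V) powr b) = 1"
        using U V by (simp add: powr_divide)
      then have "ennreal (U powr a * V powr b) * (ennreal ((1/U) powr a) * ennreal ((1/V) powr b)) = 1"
        using U V by (simp flip: ennreal_mult)
      then show ?thesis
        using U V by (simp add: epowr_mult epowr_ennreal) (metis mult.assoc mult.left_commute mult_1)
    qed
    have "(\<integral>\<^sup>+x. u x epowr a * v x epowr b \<partial>M) \<le>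
      (\<integral>\<^sup>+x. ennreal (U powr a * V powr b) *
        (ennreal a * (ennreal (1/U) * u x) + ennreal b * (ennreal (1/V) * v x)) \<partial>M)"
      unfolding scale by (intro nn_integral_mono mult_left_mono young) auto
    also have "\<dots> = ennreal (U powr a * V powr b) *
        (ennreal a * (ennreal (1/U) * ?U) + ennreal b * (ennreal (1/V) * ?V))"
      by (simp add: nn_integral_cmult nn_integral_add)
    also have "\<dots> = ennreal (U powr a * V powr b)"
      using U V a b ab by (simp flip: ennreal_mult ennreal_plus)
    also have "\<dots> = ?U epowr a * ?V epowr b"
      using U V by (simp add: epowr_ennreal ennreal_mult)
    finally show ?thesis .
  qed
qed

section \<open>Distribution functions of diffuse finite measures\<close>

text \<open>The distribution function of \<open>N\<close>, indexed by points rather than levels.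
  With \<open>- N\<close> in place of \<open>N\<close> it gives the mass strictly above x, so S and
  G are both instances of it.\<close>

definition cumul :: "('a \<Rightarrow> real) \<Rightarrow> 'a measure \<Rightarrow> 'a \<Rightarrow> ennreal" where
  "cumul N \<mu> x = emeasure \<mu> {z \<in> space \<mu>. N z < N x}"

lemma cumul_eq_nn_integral:
  assumes [measurable]: "N \<in> borel_measurable \<mu>"
  shows "cumul N \<mu> x = (\<integral>\<^sup>+z. (if N z < N x then 1 else 0) \<partial>\<mu>)"
proof -
  have "(\<integral>\<^sup>+z. (if N z < N x then 1 else 0) \<partial>\<mu>)
      = (\<integral>\<^sup>+z. indicator {z \<in> space \<mu>. N z < N x} z \<partial>\<mu>)"
    by (intro nn_integral_cong) auto
  then show ?thesis
    by (simp add: cumul_def)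
qed

lemma cumul_density:
  assumes [measurable]: "N \<in> borel_measurable \<mu>" "g \<in> borel_measurable \<mu>"
  shows "cumul N (density \<mu> g) x = (\<integral>\<^sup>+z. (if N z < N x then g z else 0) \<partial>\<mu>)"
  by (subst cumul_eq_nn_integral)
    (auto simp: nn_integral_density intro!: nn_integral_cong)

lemma cumul_le_emeasure_space: "cumul N \<mu> x \<le> emeasure \<mu> (space \<mu>)"
  unfolding cumul_def by (rule emeasure_space)

lemma cumul_mono:
  assumes [measurable]: "N \<in> borel_measurable \<mu>" and "N x \<le> N y"
  shows "cumul N \<mu> x \<le> cumul N \<mu> y"
  using assms(2) unfolding cumul_def by (intro emeasure_mono) auto

lemma measurable_cumul:
  assumes "sigma_finite_measure \<mu>"
    and [measurable]: "N \<in> borel_measurable \<mu>" "N \<in> borel_measurable M"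
  shows "cumul N \<mu> \<in> borel_measurable M"
proof -
  interpret sigma_finite_measure \<mu> by fact
  have "(\<lambda>x. \<integral>\<^sup>+z. (if N z < N x then 1 else 0) \<partial>\<mu>) \<in> borel_measurable M"
    by measurable
  also have "(\<lambda>x. \<integral>\<^sup>+z. (if N z < N x then 1 else 0) \<partial>\<mu>) = cumul N \<mu>"
    by (rule ext) (simp add: cumul_eq_nn_integral)
  finally show ?thesis .
qed

text \<open>Null level sets mean that almost every point is ranked strictly above or below any given
  one; the calculus for \<open>cumul\<close> below rests on this.\<close>

locale diffuse_finite = finite_measure \<mu> for \<mu> :: "'a measure" +
  fixes N :: "'a \<Rightarrow> real"
  assumes measurable_rank [measurable]: "N \<in> borel_measurable \<mu>"
    and null_level: "emeasure \<mu> {x \<in> space \<mu>. N x = t} = 0"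

lemma diffuse_finite_densityI:
  assumes [measurable]: "N \<in> borel_measurable M" "h \<in> borel_measurable M"
    and null: "\<And>t. emeasure M {x \<in> space M. N x = t} = 0" and fin: "(\<integral>\<^sup>+x. h x \<partial>M) \<noteq> top"
  shows "diffuse_finite (density M h) N"
proof (intro diffuse_finite.intro diffuse_finite_axioms.intro finite_measureI)
  have "emeasure (density M h) (space (density M h)) = (\<integral>\<^sup>+x. h x \<partial>M)"
    by (auto simp: emeasure_density intro!: nn_integral_cong)
  with fin show "emeasure (density M h) (space (density M h)) \<noteq> \<infinity>"
    by simp
  fix t
  show "emeasure (density M h) {x \<in> space (density M h). N x = t} = 0"
    using null[of t]
    by (intro absolutely_continuousD[OF absolutely_continuousI_density[of h M]]) auto
qed measurable

context diffuse_finite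
begin

lemma diffuse_finite_uminus: "diffuse_finite \<mu> (\<lambda>x. - N x)"
proof unfold_locales
  fix t
  have "{x \<in> space \<mu>. - N x = t} = {x \<in> space \<mu>. N x = - t}"
    by auto
  then show "emeasure \<mu> {x \<in> space \<mu>. - N x = t} = 0"
    by (simp add: null_level)
qed measurable

lemma diffuse_finite_density:
  assumes [measurable]: "g \<in> borel_measurable \<mu>" and "\<And>x. g x \<le> ennreal K"
  shows "diffuse_finite (density \<mu> g) N"
proof (rule diffuse_finite_densityI)
  have "(\<integral>\<^sup>+x. g x \<partial>\<mu>) \<le> (\<integral>\<^sup>+x. ennreal K \<partial>\<mu>)"
    by (intro nn_integral_mono assms)
  also have "\<dots> = ennreal K * emeasure \<mu> (space \<mu>)"
    by simp
  finally show "(\<integral>\<^sup>+x. g x \<partial>\<mu>) \<noteq> top"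
    by (auto simp: top_unique ennreal_mult_eq_top_iff)
qed (auto simp: null_level)

lemma AE_rank_neq: "AE y in \<mu>. N y \<noteq> t"
  using null_level[of t] by (subst AE_iff_measurable[OF _ refl]) auto

lemma measurable_cumul_self [measurable]: "cumul N \<mu> \<in> borel_measurable \<mu>"
  by (intro measurable_cumul) (auto intro: sigma_finite_measure_axioms)

lemma cumul_finite: "cumul N \<mu> x < top"
  using cumul_le_emeasure_space[of N \<mu> x] emeasure_finite[of "space \<mu>"]
  by (auto simp: less_top[symmetric] top_unique)

text \<open>Of two points drawn from the sublevel set of \<open>cumul N \<mu>\<close>, one lies strictly below the other
  almost surely; integrating first over the lower one gives \<open>m\<^sup>2 \<le> 2 t m\<close> for the mass \<open>m\<close>.\<close>

lemma emeasure_cumul_le: "emeasure \<mu> {x \<in> space \<mu>. cumul N \<mu> x \<le> t} \<le> 2 * t"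
proof -
  interpret P: pair_sigma_finite \<mu> \<mu> ..
  define D where "D = {x \<in> space \<mu>. cumul N \<mu> x \<le> t}"
  define m where "m = emeasure \<mu> D"
  have [measurable]: "D \<in> sets \<mu>"
    unfolding D_def by measurable
  \<comment> \<open>\<open>k x y\<close> marks the pairs in D with y strictly below x. Off the ties,
    exactly one of \<open>k x y\<close> and \<open>k y x\<close> is 1 on pairs in D, so their sum
    recovers the whole product set almost everywhere.\<close>
  define k :: "'a \<Rightarrow> 'a \<Rightarrow> ennreal"
    where "k x y = indicator D x * (indicator D y * (if N y < N x then 1 else 0))" for x y
  have [measurable]: "case_prod k \<in> borel_measurable (\<mu> \<Otimes>\<^sub>M \<mu>)"
    unfolding k_def by measurable
  have [measurable]: "k x \<in> borel_measurable \<mu>" "(\<lambda>y. k y x) \<in> borel_measurable \<mu>" for x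
    unfolding k_def by measurable
  have inner: "(\<integral>\<^sup>+y. k x y \<partial>\<mu>) \<le> t * indicator D x" for x
  proof (cases "x \<in> D")
    case True
    have "(\<integral>\<^sup>+y. k x y \<partial>\<mu>) \<le> (\<integral>\<^sup>+y. (if N y < N x then 1 else 0) \<partial>\<mu>)"
      by (intro nn_integral_mono) (auto simp: k_def indicator_def)
    also have "\<dots> = cumul N \<mu> x"
      by (simp add: cumul_eq_nn_integral)
    finally show ?thesis
      using True by (auto simp: D_def)
  qed (simp add: k_def)
  have "m * m = (\<integral>\<^sup>+x. \<integral>\<^sup>+y. indicator D x * indicator D y \<partial>\<mu> \<partial>\<mu>)"
    by (simp add: nn_integral_cmult nn_integral_multc m_def)
  also have "\<dots> = (\<integral>\<^sup>+x. \<integral>\<^sup>+y. k x y + k y x \<partial>\<mu> \<partial>\<mu>)"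
  proof (rule nn_integral_cong, rule nn_integral_cong_AE)
    fix x
    show "AE y in \<mu>. indicator D x * indicator D y = k x y + k y x"
      using AE_rank_neq[of "N x"] by eventually_elim (auto simp: k_def indicator_def)
  qed
  also have "\<dots> = (\<integral>\<^sup>+x. \<integral>\<^sup>+y. k x y \<partial>\<mu> \<partial>\<mu>) + (\<integral>\<^sup>+x. \<integral>\<^sup>+y. k y x \<partial>\<mu> \<partial>\<mu>)"
    by (simp add: nn_integral_add)
  also have "(\<integral>\<^sup>+x. \<integral>\<^sup>+y. k y x \<partial>\<mu> \<partial>\<mu>) = (\<integral>\<^sup>+x. \<integral>\<^sup>+y. k x y \<partial>\<mu> \<partial>\<mu>)"
    by (rule P.Fubini') measurable
  also have "(\<integral>\<^sup>+x. \<integral>\<^sup>+y. k x y \<partial>\<mu> \<partial>\<mu>) + (\<integral>\<^sup>+x. \<integral>\<^sup>+y. k x y \<partial>\<mu> \<partial>\<mu>)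
      = 2 * (\<integral>\<^sup>+x. \<integral>\<^sup>+y. k x y \<partial>\<mu> \<partial>\<mu>)"
    by (simp add: mult_2)
  also have "\<dots> \<le> 2 * (\<integral>\<^sup>+x. t * indicator D x \<partial>\<mu>)"
    by (intro mult_left_mono nn_integral_mono inner) auto
  also have "\<dots> = m * (2 * t)"
    by (simp add: nn_integral_cmult m_def mult_ac)
  finally have "m * m \<le> m * (2 * t)" .
  moreover have "m \<noteq> top"
    by (simp add: m_def)
  ultimately have "m \<le> 2 * t"
    by (cases "m = 0") (auto simp: ennreal_mult_le_mult_iff)
  then show ?thesis
    by (simp add: m_def D_def)
qed

text \<open>The case t = 0 of \<open>emeasure_cumul_le\<close>. It licenses cancelling opposite
  powers of S almost everywhere.\<close>

lemma AE_cumul_pos: "AE x in \<mu>. cumul N \<mu> x \<noteq> 0"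
proof (subst AE_iff_measurable[OF _ refl])
  show "emeasure \<mu> {x \<in> space \<mu>. \<not> cumul N \<mu> x \<noteq> 0} = 0"
    using emeasure_cumul_le[of 0] by simp
qed measurable

text \<open>Up to the constant, this stands in for the identity F^r = r * (integral of F^(r-1)
  dF).\<close>

lemma cumul_powr_le:
  assumes r: "1 \<le> r"
  shows "cumul N \<mu> x epowr r
    \<le> ennreal (4 powr r) * (\<integral>\<^sup>+z. (if N z < N x then cumul N \<mu> z epowr (r - 1) else 0) \<partial>\<mu>)"
proof -
  obtain s where s: "cumul N \<mu> x = ennreal s" "0 \<le> s"
    using cumul_finite[of x] by (cases "cumul N \<mu> x") auto
  \<comment> \<open>By \<open>emeasure_cumul_le\<close> the removed points have mass at most s / 2,
    so E has mass at least s / 2. Only s / 4 of it is used, so that mass times integrand is the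
    single power (s / 4)^r; hence the constant 4^r.\<close>
  define E where "E = {z \<in> space \<mu>. N z < N x} - {z \<in> space \<mu>. cumul N \<mu> z \<le> ennreal (s / 4)}"
  have [measurable]: "E \<in> sets \<mu>"
    unfolding E_def by measurable
  have "emeasure \<mu> {z \<in> space \<mu>. N z < N x}
      \<le> emeasure \<mu> (E \<union> {z \<in> space \<mu>. cumul N \<mu> z \<le> ennreal (s / 4)})"
    by (intro emeasure_mono) (auto simp: E_def)
  also have "\<dots> \<le> emeasure \<mu> E + emeasure \<mu> {z \<in> space \<mu>. cumul N \<mu> z \<le> ennreal (s / 4)}"
    by (intro emeasure_subadditive) auto
  also have "\<dots> \<le> emeasure \<mu> E + 2 * ennreal (s / 4)"
    by (intro add_left_mono emeasure_cumul_le)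
  finally have "ennreal s \<le> emeasure \<mu> E + ennreal (s / 2)"
    using s by (simp add: cumul_def[symmetric] ennreal_mult'[symmetric] flip: ennreal_numeral)
  then have E: "ennreal (s / 4) \<le> emeasure \<mu> E"
    using s emeasure_finite[of E] by (cases "emeasure \<mu> E") (auto simp flip: ennreal_plus)
  have "ennreal ((s / 4) powr r) = ennreal (s / 4) epowr (r - 1) * ennreal (s / 4)"
    using epowr_add[of "ennreal (s / 4)" "r - 1" 1] s by (simp add: epowr_ennreal)
  also have "\<dots> \<le> ennreal (s / 4) epowr (r - 1) * emeasure \<mu> E"
    by (intro mult_left_mono E) auto
  also have "\<dots> = (\<integral>\<^sup>+z. ennreal (s / 4) epowr (r - 1) * indicator E z \<partial>\<mu>)"
    by (simp add: nn_integral_cmult)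
  also have "\<dots> \<le> (\<integral>\<^sup>+z. (if N z < N x then cumul N \<mu> z epowr (r - 1) else 0) \<partial>\<mu>)"
    using r by (intro nn_integral_mono) (auto simp: E_def indicator_def not_le intro!: epowr_mono)
  finally have *: "ennreal ((s / 4) powr r)
      \<le> (\<integral>\<^sup>+z. (if N z < N x then cumul N \<mu> z epowr (r - 1) else 0) \<partial>\<mu>)" .
  have "cumul N \<mu> x epowr r = ennreal (4 powr r) * ennreal ((s / 4) powr r)"
    using s by (simp add: epowr_ennreal powr_divide flip: ennreal_mult)
  also note mult_left_mono[OF *]
  finally show ?thesis by simp
qed

end

section \<open>Averaging with respect to a diffuse finite measure\<close>

text \<open>Division by T^\<theta>, which is legitimate only for finite nonzero T. It closes
  estimates in which the quantity to be bounded reappears on the right with an exponent below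
  1.\<close>

lemma ennreal_absorb:
  assumes fin: "T < top" and le: "T \<le> B * T epowr \<theta>" and \<theta>: "0 < \<theta>" "\<theta> < 1"
  shows "T \<le> B epowr (1 / (1 - \<theta>))"
proof (cases "T = 0")
  case False
  have "T epowr \<theta> * T epowr (1 - \<theta>) = T"
    by (simp flip: epowr_add)
  with le have "T epowr \<theta> * T epowr (1 - \<theta>) \<le> T epowr \<theta> * B"
    by (simp add: mult.commute)
  then have "T epowr (1 - \<theta>) \<le> B"
    using False fin by (simp add: ennreal_mult_le_mult_iff less_top)
  then have "(T epowr (1 - \<theta>)) epowr (1 / (1 - \<theta>)) \<le> B epowr (1 / (1 - \<theta>))"
    using \<theta> by (intro epowr_mono) auto
  then show ?thesis
    using \<theta> by (simp add: epowr_epowr)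
qed simp

text \<open>Tonelli's theorem on the region where z lies strictly below x.\<close>

lemma nn_integral_rank_swap:
  fixes N :: "'a \<Rightarrow> real"
  assumes "sigma_finite_measure \<mu>" "sigma_finite_measure \<nu>"
    and [measurable]: "N \<in> borel_measurable \<mu>" "N \<in> borel_measurable \<nu>"
      "u \<in> borel_measurable \<nu>" "v \<in> borel_measurable \<mu>"
  shows "(\<integral>\<^sup>+x. u x * (\<integral>\<^sup>+z. (if N z < N x then v z else 0) \<partial>\<mu>) \<partial>\<nu>)
    = (\<integral>\<^sup>+z. v z * (\<integral>\<^sup>+x. (if N z < N x then u x else 0) \<partial>\<nu>) \<partial>\<mu>)"
proof -
  interpret pair_sigma_finite \<mu> \<nu>
    using assms(1,2) by (rule pair_sigma_finite.intro)
  have "(\<integral>\<^sup>+x. u x * (\<integral>\<^sup>+z. (if N z < N x then v z else 0) \<partial>\<mu>) \<partial>\<nu>)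
      = (\<integral>\<^sup>+x. \<integral>\<^sup>+z. u x * (if N z < N x then v z else 0) \<partial>\<mu> \<partial>\<nu>)"
    by (intro nn_integral_cong nn_integral_cmult[symmetric]) measurable
  also have "\<dots> = (\<integral>\<^sup>+z. \<integral>\<^sup>+x. u x * (if N z < N x then v z else 0) \<partial>\<nu> \<partial>\<mu>)"
    by (rule Fubini') measurable
  also have "\<dots> = (\<integral>\<^sup>+z. \<integral>\<^sup>+x. v z * (if N z < N x then u x else 0) \<partial>\<nu> \<partial>\<mu>)"
    by (intro nn_integral_cong) (auto simp: mult.commute)
  also have "\<dots> = (\<integral>\<^sup>+z. v z * (\<integral>\<^sup>+x. (if N z < N x then u x else 0) \<partial>\<nu>) \<partial>\<mu>)"
    by (intro nn_integral_cong nn_integral_cmult) measurable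
  finally show ?thesis .
qed

context diffuse_finite
begin

text \<open>Splitting off \<open>{x. s \<le> cumul N \<mu> x \<le> 2 * s}\<close> reduces the bound for \<open>s\<close> to the one for
  \<open>2 * s\<close>, and the integral vanishes once \<open>s\<close> exceeds the total mass.\<close>

lemma nn_integral_cumul_tail_le:
  assumes p: "1 < p" and s: "0 < s"
  shows "(\<integral>\<^sup>+x. (if ennreal s \<le> cumul N \<mu> x then cumul N \<mu> x epowr (- p) else 0) \<partial>\<mu>)
    \<le> ennreal (4 / (1 - 2 powr (1 - p)) * s powr (1 - p))"
proof -
  define w where "w = 1 - 2 powr (1 - p)"
  \<comment> \<open>c solves c = 4 + c * 2^(1-p), which is exactly what lets the bound for 2 * s
    imply the bound for s; it is positive because p > 1.\<close>
  define c where "c = 4 / w"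
  have w: "0 < w"
    using p powr_less_mono[of "1 - p" 0 2] by (simp add: w_def)
  then have "0 < c" "c * w = 4"
    by (simp_all add: c_def)
  then have c: "0 < c" "4 + c * 2 powr (1 - p) = c"
    by (simp_all add: w_def algebra_simps)
  define W where "W s = (\<integral>\<^sup>+x. (if ennreal s \<le> cumul N \<mu> x then cumul N \<mu> x epowr (- p) else 0) \<partial>\<mu>)" for s
  \<comment> \<open>On the band between s and 2 * s the integrand is at most s^(-p), and the band
    has mass at most 4 * s.\<close>
  have step: "W s \<le> ennreal (4 * s powr (1 - p)) + W (2 * s)" if s: "0 < s" for s
  proof -
    have pt: "(if ennreal s \<le> cumul N \<mu> x then cumul N \<mu> x epowr (- p) else 0)
      \<le> ennreal (s powr (- p)) * indicator {x \<in> space \<mu>. cumul N \<mu> x \<le> ennreal (2 * s)} x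
        + (if ennreal (2 * s) \<le> cumul N \<mu> x then cumul N \<mu> x epowr (- p) else 0)"
      if "x \<in> space \<mu>" for x
    proof -
      obtain t where t: "cumul N \<mu> x = ennreal t" "0 \<le> t"
        using cumul_finite[of x] by (cases "cumul N \<mu> x") auto
      show ?thesis
        using that s p t by (auto simp: epowr_ennreal not_le intro!: ennreal_leI powr_mono2')
    qed
    have "W s \<le> (\<integral>\<^sup>+x. ennreal (s powr (- p)) * indicator {x \<in> space \<mu>. cumul N \<mu> x \<le> ennreal (2 * s)} x
        + (if ennreal (2 * s) \<le> cumul N \<mu> x then cumul N \<mu> x epowr (- p) else 0) \<partial>\<mu>)"
      unfolding W_def by (intro nn_integral_mono pt)
    also have "\<dots> = ennreal (s powr (- p)) * emeasure \<mu> {x \<in> space \<mu>. cumul N \<mu> x \<le> ennreal (2 * s)}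
        + W (2 * s)"
      unfolding W_def by (subst nn_integral_add) (auto simp: nn_integral_cmult)
    also have "\<dots> \<le> ennreal (s powr (- p)) * (2 * ennreal (2 * s)) + W (2 * s)"
      by (intro add_right_mono mult_left_mono emeasure_cumul_le) auto
    also have "ennreal (s powr (- p)) * (2 * ennreal (2 * s)) = ennreal (4 * (s powr (- p) * s powr 1))"
      using s by (simp add: mult_ac flip: ennreal_mult ennreal_numeral)
    also have "s powr (- p) * s powr 1 = s powr (1 - p)"
      using s by (simp add: powr_diff powr_minus_divide)
    finally show ?thesis .
  qed
  have "W s \<le> ennreal (c * s powr (1 - p))" if "0 < s" "measure \<mu> (space \<mu>) < s * 2 ^ n" for n s
    using that
  proof (induction n arbitrary: s)
    case 0
    have "cumul N \<mu> x < ennreal s" for x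
    proof -
      have "cumul N \<mu> x \<le> ennreal (measure \<mu> (space \<mu>))"
        using cumul_le_emeasure_space[of N \<mu> x] by (simp add: emeasure_eq_measure)
      also have "\<dots> < ennreal s"
        using 0 by (intro ennreal_lessI) auto
      finally show ?thesis .
    qed
    then have "W s = 0"
      by (simp add: W_def flip: not_less)
    then show ?case by simp
  next
    case (Suc n)
    have "W s \<le> ennreal (4 * s powr (1 - p)) + W (2 * s)"
      using Suc by (intro step)
    also have "\<dots> \<le> ennreal (4 * s powr (1 - p)) + ennreal (c * (2 * s) powr (1 - p))"
      using Suc.prems by (intro add_left_mono Suc.IH) (auto simp: mult_ac)
    also have "\<dots> = ennreal ((4 + c * 2 powr (1 - p)) * s powr (1 - p))"
      using Suc.prems \<open>0 < c\<close> by (simp add: powr_mult algebra_simps flip: ennreal_plus)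
    finally show ?case
      using c by simp
  qed
  moreover obtain n where "measure \<mu> (space \<mu>) / s < 2 ^ n"
    using real_arch_pow[of 2 "measure \<mu> (space \<mu>) / s"] by auto
  ultimately have "W s \<le> ennreal (c * s powr (1 - p))"
    using s by (auto simp: field_simps)
  then show ?thesis
    by (simp add: W_def c_def w_def)
qed

text \<open>Hardy's inequality for the averages F / S of g over the points below x, with the
  quotient written as a product of powers. Expanding F^p by \<open>cumul_powr_le\<close>, swapping
  the integrals and applying the tail bound and Hoelder's inequality bounds the left side T by a
  multiple of T^((p-1)/p), and T is then absorbed. The constant is independent of K.\<close>

lemma cumul_ratio_bound:
  assumes p: "1 < p" and [measurable]: "g \<in> borel_measurable \<mu>" and g: "\<And>x. g x \<le> ennreal K"
  shows "(\<integral>\<^sup>+x. cumul N (density \<mu> g) x epowr p * cumul N \<mu> x epowr (- p) \<partial>\<mu>)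
    \<le> ennreal (4 powr p * (4 / (1 - 2 powr (1 - p)))) epowr p * (\<integral>\<^sup>+x. g x epowr p \<partial>\<mu>)"
proof -
  interpret \<kappa>: diffuse_finite "density \<mu> g" N
    using g by (intro diffuse_finite_density) auto
  define F where "F = cumul N (density \<mu> g)"
  define S where "S = cumul N \<mu>"
  have [measurable]: "F \<in> borel_measurable \<mu>" "S \<in> borel_measurable \<mu>"
    unfolding F_def S_def using \<kappa>.measurable_cumul_self by simp_all
  define c where "c = 4 / (1 - 2 powr (1 - p))"
  have "2 powr (1 - p) < 1"
    using p powr_less_mono[of "1 - p" 0 2] by simp
  then have c: "0 < c"
    by (simp add: c_def)
  define T where "T = (\<integral>\<^sup>+x. F x epowr p * S x epowr (- p) \<partial>\<mu>)"
  define I where "I = (\<integral>\<^sup>+x. g x epowr p \<partial>\<mu>)"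
  have S_fin: "S x < top" for x
    by (simp add: S_def cumul_finite)
  have FS: "F x \<le> ennreal K * S x" for x
  proof -
    have "F x \<le> (\<integral>\<^sup>+z. ennreal K * (if N z < N x then 1 else 0) \<partial>\<mu>)"
      unfolding F_def cumul_density[OF measurable_rank assms(2)]
      using g by (intro nn_integral_mono) auto
    then show ?thesis
      by (simp add: nn_integral_cmult S_def cumul_eq_nn_integral)
  qed
  \<comment> \<open>The a priori bound F \<le> K * S makes T finite, as the absorption at the end
    requires.\<close>
  have "T \<le> (\<integral>\<^sup>+x. ennreal K epowr p \<partial>\<mu>)"
    unfolding T_def
  proof (intro nn_integral_mono)
    fix x
    have "F x epowr p * S x epowr (- p) \<le> (ennreal K * S x) epowr p * S x epowr (- p)"
      using p by (intro mult_right_mono epowr_mono FS) auto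
    also have "\<dots> = ennreal K epowr p * S x epowr 0"
      by (simp add: epowr_mult mult.assoc flip: epowr_add)
    also have "S x epowr 0 \<le> 1"
      using S_fin[of x] by (cases "S x") (auto simp: epowr_ennreal)
    finally show "F x epowr p * S x epowr (- p) \<le> ennreal K epowr p"
      by (simp add: mult_left_mono)
  qed
  then have T_fin: "T < top"
    by (auto simp: top_unique ennreal_mult_eq_top_iff simp flip: less_top)
  have tail: "(\<integral>\<^sup>+x. (if N z < N x then S x epowr (- p) else 0) \<partial>\<mu>) \<le> ennreal c * S z epowr (1 - p)"
    if nz: "S z \<noteq> 0" for z
  proof -
    obtain s where s: "S z = ennreal s" "0 < s"
      using S_fin[of z] nz by (cases "S z") (auto simp: ennreal_eq_0_iff not_le)
    \<comment> \<open>Every x above z satisfies S x \<ge> S z = s, so the points above z lie in the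
      region of the tail estimate.\<close>
    have "(\<integral>\<^sup>+x. (if N z < N x then S x epowr (- p) else 0) \<partial>\<mu>)
      \<le> (\<integral>\<^sup>+x. (if ennreal s \<le> S x then S x epowr (- p) else 0) \<partial>\<mu>)"
      using cumul_mono[OF measurable_rank, of z] s(1) by (intro nn_integral_mono) (auto simp: S_def)
    also have "\<dots> \<le> ennreal (c * s powr (1 - p))"
      unfolding S_def c_def by (rule nn_integral_cumul_tail_le[OF p s(2)])
    finally show ?thesis
      using s c by (simp add: epowr_ennreal ennreal_mult)
  qed
  have "T \<le> (\<integral>\<^sup>+x. ennreal (4 powr p) * (S x epowr (- p) *
      (\<integral>\<^sup>+z. (if N z < N x then g z * F z epowr (p - 1) else 0) \<partial>\<mu>)) \<partial>\<mu>)"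
    unfolding T_def
  proof (intro nn_integral_mono)
    fix x
    have "F x epowr p \<le> ennreal (4 powr p) *
        (\<integral>\<^sup>+z. (if N z < N x then F z epowr (p - 1) else 0) \<partial>density \<mu> g)"
      unfolding F_def using p by (intro \<kappa>.cumul_powr_le) auto
    also have "(\<integral>\<^sup>+z. (if N z < N x then F z epowr (p - 1) else 0) \<partial>density \<mu> g)
        = (\<integral>\<^sup>+z. (if N z < N x then g z * F z epowr (p - 1) else 0) \<partial>\<mu>)"
      by (subst nn_integral_density) (auto intro!: nn_integral_cong)
    finally show "F x epowr p * S x epowr (- p) \<le> ennreal (4 powr p) * (S x epowr (- p) *
      (\<integral>\<^sup>+z. (if N z < N x then g z * F z epowr (p - 1) else 0) \<partial>\<mu>))"
      by (subst mult.left_commute, subst mult.commute) (rule mult_left_mono, auto)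
  qed
  also have "\<dots> = ennreal (4 powr p) * (\<integral>\<^sup>+x. S x epowr (- p) *
      (\<integral>\<^sup>+z. (if N z < N x then g z * F z epowr (p - 1) else 0) \<partial>\<mu>) \<partial>\<mu>)"
    by (intro nn_integral_cmult) measurable
  also have "(\<integral>\<^sup>+x. S x epowr (- p) *
      (\<integral>\<^sup>+z. (if N z < N x then g z * F z epowr (p - 1) else 0) \<partial>\<mu>) \<partial>\<mu>)
    = (\<integral>\<^sup>+z. g z * F z epowr (p - 1) *
      (\<integral>\<^sup>+x. (if N z < N x then S x epowr (- p) else 0) \<partial>\<mu>) \<partial>\<mu>)"
    by (intro nn_integral_rank_swap) (auto intro: sigma_finite_measure_axioms)
  \<comment> \<open>The factor S^(1-p) from the tail bound completes F^(p-1) to the power (p-1)/p of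
    the integrand of T, so Hoelder's inequality gives back T with an exponent below 1.\<close>
  also have "\<dots> \<le> (\<integral>\<^sup>+z. ennreal c * ((g z epowr p) epowr (1 / p)
      * (F z epowr p * S z epowr (- p)) epowr ((p - 1) / p)) \<partial>\<mu>)"
  proof (intro nn_integral_mono_AE)
    show "AE z in \<mu>. g z * F z epowr (p - 1) *
      (\<integral>\<^sup>+x. (if N z < N x then S x epowr (- p) else 0) \<partial>\<mu>)
      \<le> ennreal c * ((g z epowr p) epowr (1 / p)
      * (F z epowr p * S z epowr (- p)) epowr ((p - 1) / p))"
      using AE_cumul_pos
    proof eventually_elim
      case (elim z)
      then have "g z * F z epowr (p - 1) * (\<integral>\<^sup>+x. (if N z < N x then S x epowr (- p) else 0) \<partial>\<mu>)
        \<le> g z * F z epowr (p - 1) * (ennreal c * S z epowr (1 - p))"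
        by (intro mult_left_mono tail) (auto simp: S_def)
      also have "\<dots> = ennreal c * ((g z epowr p) epowr (1 / p)
          * (F z epowr p * S z epowr (- p)) epowr ((p - 1) / p))"
        using p by (simp add: epowr_mult epowr_epowr mult_ac)
      finally show ?case .
    qed
  qed
  also have "\<dots> = ennreal c * (\<integral>\<^sup>+z. (g z epowr p) epowr (1 / p)
      * (F z epowr p * S z epowr (- p)) epowr ((p - 1) / p) \<partial>\<mu>)"
    by (intro nn_integral_cmult) measurable
  also have "(\<integral>\<^sup>+z. (g z epowr p) epowr (1 / p)
      * (F z epowr p * S z epowr (- p)) epowr ((p - 1) / p) \<partial>\<mu>)
      \<le> I epowr (1 / p) * T epowr ((p - 1) / p)"
    unfolding I_def T_def using p by (intro Holder_nn_integral) (auto simp: field_simps)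
  finally have "T \<le> (ennreal (4 powr p * c) * I epowr (1 / p)) * T epowr ((p - 1) / p)"
    using c by (simp add: mult_left_mono ennreal_mult mult.assoc)
  then have "T \<le> (ennreal (4 powr p * c) * I epowr (1 / p)) epowr (1 / (1 - (p - 1) / p))"
    using p T_fin by (intro ennreal_absorb) auto
  also have "1 / (1 - (p - 1) / p) = p"
    using p by (simp add: field_simps)
  finally show ?thesis
    using p by (simp add: T_def I_def F_def S_def c_def epowr_mult epowr_epowr)
qed

end

section \<open>The two-measure inequality for finite measures\<close>

text \<open>Two applications of the two-factor inequality, the second and third factors being first
  joined into one power b + c.\<close>

lemma Holder_nn_integral_three:
  assumes [measurable]: "u \<in> borel_measurable M" "v \<in> borel_measurable M" "w \<in> borel_measurable M"
    and a: "0 < a" and b: "0 < b" and c: "0 < c" and abc: "a + b + c = 1"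
  shows "(\<integral>\<^sup>+x. u x epowr a * (v x epowr b * w x epowr c) \<partial>M)
    \<le> (\<integral>\<^sup>+x. u x \<partial>M) epowr a * ((\<integral>\<^sup>+x. v x \<partial>M) epowr b * (\<integral>\<^sup>+x. w x \<partial>M) epowr c)"
proof -
  let ?h = "\<lambda>x. v x epowr (b / (b + c)) * w x epowr (c / (b + c))"
  have "(\<integral>\<^sup>+x. u x epowr a * (v x epowr b * w x epowr c) \<partial>M)
      = (\<integral>\<^sup>+x. u x epowr a * ?h x epowr (b + c) \<partial>M)"
    using b c by (simp add: epowr_mult epowr_epowr)
  also have "\<dots> \<le> (\<integral>\<^sup>+x. u x \<partial>M) epowr a * (\<integral>\<^sup>+x. ?h x \<partial>M) epowr (b + c)"
    using a b c abc by (intro Holder_nn_integral) auto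
  also have "(\<integral>\<^sup>+x. ?h x \<partial>M) epowr (b + c)
      \<le> ((\<integral>\<^sup>+x. v x \<partial>M) epowr (b / (b + c)) * (\<integral>\<^sup>+x. w x \<partial>M) epowr (c / (b + c))) epowr (b + c)"
    using b c by (intro epowr_mono Holder_nn_integral) (auto simp flip: add_divide_distrib)
  also have "\<dots> = (\<integral>\<^sup>+x. v x \<partial>M) epowr b * (\<integral>\<^sup>+x. w x \<partial>M) epowr c"
    using b c by (simp add: epowr_mult epowr_epowr)
  finally show ?thesis
    by (simp add: mult_left_mono)
qed

locale diffuse_finite_pair = \<mu>: diffuse_finite \<mu> N + \<nu>: diffuse_finite \<nu> N
  for \<mu> \<nu> :: "'a measure" and N +
  assumes sets_eq [measurable_cong]: "sets \<nu> = sets \<mu>"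
begin

text \<open>With \<mu> = \<psi>^(1-p') dx, \<nu> = \<phi> dx, a = \<delta>/q and b = \<delta>/q',
  this is the quantity \<open>A\<^sub>3\<close> of the theorem.\<close>

definition hardy_A :: "real \<Rightarrow> real \<Rightarrow> ennreal" where
  "hardy_A a b = (\<integral>\<^sup>+x. cumul (\<lambda>x. - N x) \<nu> x epowr a * cumul N \<mu> x epowr b \<partial>\<mu>)"

text \<open>Reversing the order turns the bounds for \<open>cumul\<close> into bounds for the mass
  above a point, that is, for G.\<close>

sublocale \<nu>': diffuse_finite \<nu> "\<lambda>x. - N x"
  by (rule \<nu>.diffuse_finite_uminus)

lemma measurable_cumuls [measurable]:
  "cumul N \<mu> \<in> borel_measurable \<mu>" "cumul N \<mu> \<in> borel_measurable \<nu>"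
  "cumul (\<lambda>x. - N x) \<nu> \<in> borel_measurable \<mu>" "cumul (\<lambda>x. - N x) \<nu> \<in> borel_measurable \<nu>"
  by (auto intro!: measurable_cumul \<mu>.sigma_finite_measure_axioms \<nu>.sigma_finite_measure_axioms)

lemma cumul_uminus_eq: "cumul (\<lambda>x. - N x) \<nu> z = (\<integral>\<^sup>+x. (if N z < N x then 1 else 0) \<partial>\<nu>)"
  by (simp add: cumul_eq_nn_integral)

lemma rank_swap:
  assumes [measurable]: "u \<in> borel_measurable \<nu>" "v \<in> borel_measurable \<mu>"
  shows "(\<integral>\<^sup>+x. u x * (\<integral>\<^sup>+z. (if N z < N x then v z else 0) \<partial>\<mu>) \<partial>\<nu>)
    = (\<integral>\<^sup>+z. v z * (\<integral>\<^sup>+x. (if N z < N x then u x else 0) \<partial>\<nu>) \<partial>\<mu>)"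
  by (intro nn_integral_rank_swap \<mu>.sigma_finite_measure_axioms \<nu>.sigma_finite_measure_axioms)
    measurable

text \<open>The constant does not involve K, which later allows truncations of an unbounded g to
  pass to the limit.\<close>

lemma hardy_sufficient:
  assumes q: "1 < q" and pq: "q < p"
    and [measurable]: "g \<in> borel_measurable \<mu>" and g: "\<And>x. g x \<le> ennreal K"
  shows "(\<integral>\<^sup>+x. cumul N (density \<mu> g) x epowr q \<partial>\<nu>)
    \<le> ennreal (4 powr q * (4 powr p * (4 / (1 - 2 powr (1 - p)))) powr (q - 1)) *
      (hardy_A (p / (p - q)) ((q - 1) * p / (p - q)) epowr ((p - q) / p)
        * (\<integral>\<^sup>+x. g x epowr p \<partial>\<mu>) epowr (q / p))"
proof -
  interpret \<kappa>: diffuse_finite "density \<mu> g" N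
    using g by (intro \<mu>.diffuse_finite_density) auto
  define F where "F = cumul N (density \<mu> g)"
  define S where "S = cumul N \<mu>"
  define G where "G = cumul (\<lambda>x. - N x) \<nu>"
  have [measurable]: "F \<in> borel_measurable \<mu>" "S \<in> borel_measurable \<mu>" "G \<in> borel_measurable \<mu>"
    unfolding F_def S_def G_def using \<kappa>.measurable_cumul_self by simp_all
  define \<alpha> where "\<alpha> = p / (p - q)"
  define \<beta> where "\<beta> = (q - 1) * p / (p - q)"
  define b where "b = 4 powr p * (4 / (1 - 2 powr (1 - p)))"
  have "2 powr (1 - p) < 1"
    using q pq powr_less_mono[of "1 - p" 0 2] by simp
  then have b: "0 < b"
    by (simp add: b_def)
  define I where "I = (\<integral>\<^sup>+x. g x epowr p \<partial>\<mu>)"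
  define T where "T = (\<integral>\<^sup>+x. F x epowr p * S x epowr (- p) \<partial>\<mu>)"
  have T: "T \<le> ennreal b epowr p * I"
    unfolding T_def F_def S_def b_def I_def using q pq g by (intro \<mu>.cumul_ratio_bound) auto
  \<comment> \<open>The factor 1 is the function \<open>u\<close> in \<open>rank_swap\<close>; after
    the swap its integral over the points above z is G z.\<close>
  have "(\<integral>\<^sup>+x. F x epowr q \<partial>\<nu>) \<le> (\<integral>\<^sup>+x. ennreal (4 powr q) * (1 *
      (\<integral>\<^sup>+z. (if N z < N x then g z * F z epowr (q - 1) else 0) \<partial>\<mu>)) \<partial>\<nu>)"
  proof (intro nn_integral_mono)
    fix x
    have "F x epowr q \<le> ennreal (4 powr q) *
        (\<integral>\<^sup>+z. (if N z < N x then F z epowr (q - 1) else 0) \<partial>density \<mu> g)"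
      unfolding F_def using q by (intro \<kappa>.cumul_powr_le) auto
    also have "(\<integral>\<^sup>+z. (if N z < N x then F z epowr (q - 1) else 0) \<partial>density \<mu> g)
        = (\<integral>\<^sup>+z. (if N z < N x then g z * F z epowr (q - 1) else 0) \<partial>\<mu>)"
      by (subst nn_integral_density) (auto intro!: nn_integral_cong)
    finally show "F x epowr q \<le> ennreal (4 powr q) * (1 *
      (\<integral>\<^sup>+z. (if N z < N x then g z * F z epowr (q - 1) else 0) \<partial>\<mu>))"
      by simp
  qed
  also have "\<dots> = ennreal (4 powr q) * (\<integral>\<^sup>+x. 1 *
      (\<integral>\<^sup>+z. (if N z < N x then g z * F z epowr (q - 1) else 0) \<partial>\<mu>) \<partial>\<nu>)"
    by (intro nn_integral_cmult) measurable
  also have "(\<integral>\<^sup>+x. 1 *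
      (\<integral>\<^sup>+z. (if N z < N x then g z * F z epowr (q - 1) else 0) \<partial>\<mu>) \<partial>\<nu>)
    = (\<integral>\<^sup>+z. g z * F z epowr (q - 1) * G z \<partial>\<mu>)"
    unfolding G_def cumul_uminus_eq by (intro rank_swap) measurable
  \<comment> \<open>The product S^(1-q) * S^(q-1), equal to 1 wherever S is nonzero, is inserted.
    The exponents 1/p, (q-1)/p and (p-q)/p then sum to 1, and the three integrands are those of I, T
    and \<open>hardy_A\<close>.\<close>
  also have "\<dots> = (\<integral>\<^sup>+z. (g z epowr p) epowr (1 / p) *
      ((F z epowr p * S z epowr (- p)) epowr ((q - 1) / p) *
       (G z epowr \<alpha> * S z epowr \<beta>) epowr ((p - q) / p)) \<partial>\<mu>)"
  proof (intro nn_integral_cong_AE)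
    show "AE z in \<mu>. g z * F z epowr (q - 1) * G z = (g z epowr p) epowr (1 / p) *
      ((F z epowr p * S z epowr (- p)) epowr ((q - 1) / p) *
       (G z epowr \<alpha> * S z epowr \<beta>) epowr ((p - q) / p))"
      using \<mu>.AE_cumul_pos
    proof eventually_elim
      case (elim z)
      then have "S z epowr 0 = 1"
        using \<mu>.cumul_finite[of z] by (cases "S z") (auto simp: S_def epowr_ennreal ennreal_eq_0_iff)
      then have "S z epowr (1 - q) * S z epowr (q - 1) = 1"
        by (simp flip: epowr_add)
      moreover have "\<alpha> * ((p - q) / p) = 1" "\<beta> * ((p - q) / p) = q - 1"
        using q pq by (simp_all add: \<alpha>_def \<beta>_def)
      ultimately show ?case
        using q pq by (simp add: epowr_mult epowr_epowr) (metis mult.assoc mult.commute mult_1)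
    qed
  qed
  also have "\<dots> \<le> I epowr (1 / p) *
      (T epowr ((q - 1) / p) * hardy_A \<alpha> \<beta> epowr ((p - q) / p))"
    unfolding I_def T_def hardy_A_def S_def[symmetric] G_def[symmetric]
    using q pq by (intro Holder_nn_integral_three) (auto simp flip: add_divide_distrib)
  also have "\<dots> \<le> I epowr (1 / p) *
      ((ennreal b epowr p * I) epowr ((q - 1) / p) * hardy_A \<alpha> \<beta> epowr ((p - q) / p))"
    using q pq by (intro mult_left_mono mult_right_mono epowr_mono T) auto
  also have "\<dots> = ennreal (b powr (q - 1)) * (hardy_A \<alpha> \<beta> epowr ((p - q) / p)
      * (I epowr (1 / p) * I epowr ((q - 1) / p)))"
    using q pq b by (simp add: epowr_mult epowr_epowr epowr_ennreal powr_powr mult_ac)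
  also have "I epowr (1 / p) * I epowr ((q - 1) / p) = I epowr (q / p)"
    by (simp add: diff_divide_distrib flip: epowr_add)
  finally show ?thesis
    by (simp add: F_def I_def \<alpha>_def \<beta>_def b_def mult_left_mono ennreal_mult mult.assoc)
qed

text \<open>Supplies the finiteness needed to absorb \<open>hardy_A\<close> in the necessity proof;
  for finite measures the integrand is bounded.\<close>

lemma hardy_A_finite:
  assumes "0 \<le> a" "0 \<le> b"
  shows "hardy_A a b < top"
proof -
  have "hardy_A a b \<le> (\<integral>\<^sup>+x. emeasure \<nu> (space \<nu>) epowr a * emeasure \<mu> (space \<mu>) epowr b \<partial>\<mu>)"
    unfolding hardy_A_def using assms
    by (intro nn_integral_mono mult_mono epowr_mono cumul_le_emeasure_space) auto
  also have "\<dots> < top"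
    by (simp add: ennreal_mult_eq_top_iff less_top[symmetric])
  finally show ?thesis .
qed

text \<open>The test function is \<open>G\<^sup>\<alpha>\<^sup>/\<^sup>p S\<^sup>\<beta>\<^sup>/\<^sup>p\<close>, for which the right-hand integral equals
  \<open>hardy_A \<alpha> \<beta>\<close>.\<close>

lemma hardy_necessary:
  assumes q: "1 < q" and pq: "q < p" and C: "0 < C"
    and ineq: "\<And>g. g \<in> borel_measurable \<mu> \<Longrightarrow> (\<And>x. g x < top) \<Longrightarrow>
      (\<integral>\<^sup>+x. cumul N (density \<mu> g) x epowr q \<partial>\<nu>) \<le> ennreal C * (\<integral>\<^sup>+x. g x epowr p \<partial>\<mu>) epowr (q / p)"
  shows "hardy_A (p / (p - q)) ((q - 1) * p / (p - q))
    \<le> ennreal (4 powr (p / (p - q) + (q - 1) * p / (p - q) + 1) * C) epowr (p / (p - q))"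
proof -
  define S where "S = cumul N \<mu>"
  define G where "G = cumul (\<lambda>x. - N x) \<nu>"
  have [measurable]: "S \<in> borel_measurable \<mu>" "G \<in> borel_measurable \<mu>"
      "S \<in> borel_measurable \<nu>" "G \<in> borel_measurable \<nu>"
    unfolding S_def G_def by measurable
  define \<alpha> where "\<alpha> = p / (p - q)"
  define \<gamma> where "\<gamma> = (q - 1) / (p - q)"
  define \<beta> where "\<beta> = (q - 1) * p / (p - q)"
  \<comment> \<open>The exponents of g are forced: its p-th power is G^\<alpha> * S^\<beta>, while
    the q-th power of G^(\<alpha>/p) * S^(\<gamma>+1) is G^(\<alpha>-1) * S^(\<beta>+1).\<close>
  have exps: "0 < \<alpha>" "1 \<le> \<alpha>" "0 < \<gamma>" "0 < \<beta>" "\<gamma> * p = \<beta>" "\<alpha> / p * q = \<alpha> - 1" "(\<gamma> + 1) * q = \<beta> + 1"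
    using q pq by (auto simp: \<alpha>_def \<beta>_def \<gamma>_def field_simps)
  define A where "A = hardy_A \<alpha> \<beta>"
  define g where "g x = G x epowr (\<alpha> / p) * S x epowr \<gamma>" for x
  have [measurable]: "g \<in> borel_measurable \<mu>"
    unfolding g_def by measurable
  have g_fin: "g x < top" for x
    using \<nu>'.cumul_finite[of x] \<mu>.cumul_finite[of x]
    by (simp add: g_def G_def S_def ennreal_mult_less_top)
  have "g x \<le> emeasure \<nu> (space \<nu>) epowr (\<alpha> / p) * emeasure \<mu> (space \<mu>) epowr \<gamma>" for x
    unfolding g_def G_def S_def using exps q pq
    by (intro mult_mono epowr_mono cumul_le_emeasure_space) auto
  moreover have "emeasure \<nu> (space \<nu>) epowr (\<alpha> / p) * emeasure \<mu> (space \<mu>) epowr \<gamma> \<noteq> top"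
    by (simp add: ennreal_mult_eq_top_iff)
  ultimately have "g x \<le> ennreal (enn2real
      (emeasure \<nu> (space \<nu>) epowr (\<alpha> / p) * emeasure \<mu> (space \<mu>) epowr \<gamma>))" for x
    by (simp add: less_top)
  then interpret \<kappa>: diffuse_finite "density \<mu> g" N
    by (intro \<mu>.diffuse_finite_density) auto
  have g_int: "(\<integral>\<^sup>+x. g x epowr p \<partial>\<mu>) = A"
    unfolding A_def hardy_A_def g_def S_def[symmetric] G_def[symmetric]
    using q pq exps by (simp add: epowr_mult epowr_epowr)
  have S_le: "S x epowr (r + 1) \<le> ennreal (4 powr (r + 1)) *
      (\<integral>\<^sup>+z. (if N z < N x then S z epowr r else 0) \<partial>\<mu>)" if "0 \<le> r" for r x
    using \<mu>.cumul_powr_le[of "r + 1" x] that unfolding S_def add_diff_cancel_right' by simp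
  have S_ge: "(\<integral>\<^sup>+z. (if N z < N x then S z epowr r else 0) \<partial>\<mu>) \<le> S x epowr (r + 1)"
    if r: "0 \<le> r" for r x
  proof -
    have "(\<integral>\<^sup>+z. (if N z < N x then S z epowr r else 0) \<partial>\<mu>)
        \<le> (\<integral>\<^sup>+z. S x epowr r * (if N z < N x then 1 else 0) \<partial>\<mu>)"
      using r by (intro nn_integral_mono) (auto simp: S_def intro!: epowr_mono cumul_mono)
    also have "\<dots> = S x epowr r * S x"
      by (simp add: nn_integral_cmult S_def cumul_eq_nn_integral)
    finally show ?thesis
      by (simp add: epowr_add)
  qed
  \<comment> \<open>G decreases with rank, so below x it is at least G x and can be taken out of the
    integral of g; what remains is an integral of S^\<gamma>.\<close>
  have F_ge: "G x epowr (\<alpha> - 1) * S x epowr (\<beta> + 1)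
      \<le> ennreal (4 powr (\<beta> + 1)) * cumul N (density \<mu> g) x epowr q" for x
  proof -
    have "G x epowr (\<alpha> / p) * S x epowr (\<gamma> + 1) \<le> G x epowr (\<alpha> / p) * (ennreal (4 powr (\<gamma> + 1)) *
        (\<integral>\<^sup>+z. (if N z < N x then S z epowr \<gamma> else 0) \<partial>\<mu>))"
      using exps by (intro mult_left_mono S_le) auto
    also have "\<dots> = ennreal (4 powr (\<gamma> + 1)) *
        (\<integral>\<^sup>+z. G x epowr (\<alpha> / p) * (if N z < N x then S z epowr \<gamma> else 0) \<partial>\<mu>)"
      by (simp add: nn_integral_cmult mult_ac)
    also have "\<dots> \<le> ennreal (4 powr (\<gamma> + 1)) * (\<integral>\<^sup>+z. (if N z < N x then g z else 0) \<partial>\<mu>)"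
      using exps q pq unfolding g_def G_def
      by (intro mult_left_mono nn_integral_mono)
        (auto intro!: mult_right_mono epowr_mono cumul_mono)
    also have "(\<integral>\<^sup>+z. (if N z < N x then g z else 0) \<partial>\<mu>) = cumul N (density \<mu> g) x"
      by (simp add: cumul_density)
    finally have "(G x epowr (\<alpha> / p) * S x epowr (\<gamma> + 1)) epowr q
        \<le> (ennreal (4 powr (\<gamma> + 1)) * cumul N (density \<mu> g) x) epowr q"
      using q by (intro epowr_mono) auto
    then show ?thesis
      using exps by (simp add: epowr_mult epowr_epowr epowr_ennreal powr_powr)
  qed
  \<comment> \<open>In place of integration by parts: expanding G^\<alpha> in the reversed order and
    swapping trades G^\<alpha> * S^\<beta> against \<mu> for G^(\<alpha>-1) * S^(\<beta>+1) against
    \<nu>, which the test function controls.\<close>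
  have "A \<le> (\<integral>\<^sup>+x. ennreal (4 powr \<alpha>) * (S x epowr \<beta> *
      (\<integral>\<^sup>+z. (if - N z < - N x then G z epowr (\<alpha> - 1) else 0) \<partial>\<nu>)) \<partial>\<mu>)"
    unfolding A_def hardy_A_def S_def[symmetric] G_def[symmetric]
  proof (intro nn_integral_mono)
    fix x
    have "G x epowr \<alpha> \<le> ennreal (4 powr \<alpha>) *
        (\<integral>\<^sup>+z. (if - N z < - N x then G z epowr (\<alpha> - 1) else 0) \<partial>\<nu>)"
      unfolding G_def using exps by (intro \<nu>'.cumul_powr_le) auto
    from mult_right_mono[OF this, of "S x epowr \<beta>"]
    show "G x epowr \<alpha> * S x epowr \<beta> \<le> ennreal (4 powr \<alpha>) * (S x epowr \<beta> *
        (\<integral>\<^sup>+z. (if - N z < - N x then G z epowr (\<alpha> - 1) else 0) \<partial>\<nu>))"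
      by (simp add: mult_ac)
  qed
  also have "\<dots> = ennreal (4 powr \<alpha>) * (\<integral>\<^sup>+x. S x epowr \<beta> *
      (\<integral>\<^sup>+z. (if N x < N z then G z epowr (\<alpha> - 1) else 0) \<partial>\<nu>) \<partial>\<mu>)"
    by (simp add: nn_integral_cmult)
  also have "(\<integral>\<^sup>+x. S x epowr \<beta> *
      (\<integral>\<^sup>+z. (if N x < N z then G z epowr (\<alpha> - 1) else 0) \<partial>\<nu>) \<partial>\<mu>)
    = (\<integral>\<^sup>+z. G z epowr (\<alpha> - 1) * (\<integral>\<^sup>+x. (if N x < N z then S x epowr \<beta> else 0) \<partial>\<mu>) \<partial>\<nu>)"
    by (rule rank_swap[symmetric]) measurable
  also have "\<dots> \<le> (\<integral>\<^sup>+z. G z epowr (\<alpha> - 1) * S z epowr (\<beta> + 1) \<partial>\<nu>)"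
    using exps by (intro nn_integral_mono mult_left_mono S_ge) auto
  also have "\<dots> \<le> (\<integral>\<^sup>+z. ennreal (4 powr (\<beta> + 1)) * cumul N (density \<mu> g) z epowr q \<partial>\<nu>)"
    by (intro nn_integral_mono F_ge)
  also have "\<dots> = ennreal (4 powr (\<beta> + 1)) * (\<integral>\<^sup>+z. cumul N (density \<mu> g) z epowr q \<partial>\<nu>)"
    using \<kappa>.sigma_finite_measure_axioms
    by (intro nn_integral_cmult borel_measurable_epowr measurable_cumul) auto
  also have "\<dots> \<le> ennreal (4 powr (\<beta> + 1)) * (ennreal C * A epowr (q / p))"
    using ineq[of g] g_fin by (intro mult_left_mono) (auto simp: g_int)
  finally have "A \<le> (ennreal (4 powr \<alpha>) * (ennreal (4 powr (\<beta> + 1)) * ennreal C)) * A epowr (q / p)"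
    by (simp add: mult_left_mono mult.assoc)
  then have "A \<le> (ennreal (4 powr \<alpha>) * (ennreal (4 powr (\<beta> + 1)) * ennreal C)) epowr (1 / (1 - q / p))"
    using q pq exps hardy_A_finite[of \<alpha> \<beta>] by (intro ennreal_absorb) (auto simp: A_def)
  also have "1 / (1 - q / p) = \<alpha>"
    using q pq by (simp add: \<alpha>_def field_simps)
  finally show ?thesis
    using C by (simp add: A_def \<alpha>_def \<beta>_def powr_add mult_ac flip: ennreal_mult)
qed

end

section \<open>Truncation and sigma-finite weights\<close>

lemma SUP_mult_SUP_ennreal:
  fixes f g :: "nat \<Rightarrow> ennreal"
  assumes "incseq f" "incseq g"
  shows "(SUP n. f n) * (SUP n. g n) = (SUP n. f n * g n)"
proof (rule antisym)
  have "f i * g j \<le> (SUP n. f n * g n)" for i j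
  proof -
    have "f i * g j \<le> f (max i j) * g (max i j)"
      using assms by (intro mult_mono) (auto simp: incseq_def)
    also have "\<dots> \<le> (SUP n. f n * g n)"
      by (rule SUP_upper) auto
    finally show ?thesis .
  qed
  then show "(SUP n. f n) * (SUP n. g n) \<le> (SUP n. f n * g n)"
    by (auto simp: SUP_mult_left_ennreal SUP_mult_right_ennreal intro!: SUP_least)
  show "(SUP n. f n * g n) \<le> (SUP n. f n) * (SUP n. g n)"
    by (intro SUP_least mult_mono SUP_upper) auto
qed

text \<open>A sigma-finite exhaustion is intersected with sublevel sets of the three functions;
  since their values are finite, every point is eventually captured. On each set the weights have
  finite mass and g is bounded.\<close>

lemma (in sigma_finite_measure) exhausting_sets_bounded:
  fixes s w g :: "'a \<Rightarrow> ennreal"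
  assumes [measurable]: "s \<in> borel_measurable M" "w \<in> borel_measurable M" "g \<in> borel_measurable M"
    and fin: "\<And>x. s x < top" "\<And>x. w x < top" "\<And>x. g x < top"
  obtains E :: "nat \<Rightarrow> 'a set" where "incseq E" "(\<Union>n. E n) = space M"
    "\<And>n. E n \<in> sets M" "\<And>n. emeasure M (E n) \<noteq> top"
    "\<And>n x. x \<in> E n \<Longrightarrow> s x \<le> of_nat n \<and> w x \<le> of_nat n \<and> g x \<le> of_nat n"
proof -
  obtain D :: "nat \<Rightarrow> 'a set" where D: "range D \<subseteq> sets M" "(\<Union>i. D i) = space M"
      "\<And>i. emeasure M (D i) \<noteq> \<infinity>" "incseq D"
    using sigma_finite_incseq by blast
  have [measurable]: "D n \<in> sets M" for n
    using D(1) by auto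
  define E where "E n = {x \<in> D n. s x \<le> of_nat n \<and> w x \<le> of_nat n \<and> g x \<le> of_nat n}" for n
  have E_eq: "E n = D n \<inter> {x \<in> space M. s x \<le> of_nat n \<and> w x \<le> of_nat n \<and> g x \<le> of_nat n}" for n
    using D(2) by (auto simp: E_def)
  show ?thesis
  proof (rule that)
    have mono: "of_nat m \<le> (of_nat n :: ennreal)" if "m \<le> n" for m n :: nat
      using that by simp
    show "incseq E"
      using D(4) by (auto simp: E_def incseq_def intro: order_trans[OF _ mono])
    show sets: "E n \<in> sets M" for n
      unfolding E_eq by measurable
    show "emeasure M (E n) \<noteq> top" for n
    proof -
      have "emeasure M (E n) \<le> emeasure M (D n)"
        by (intro emeasure_mono) (auto simp: E_def)
      then show ?thesis
        using D(3)[of n] by (auto simp: top_unique)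
    qed
    show "(\<Union>n. E n) = space M"
    proof (intro equalityI subsetI)
      fix x assume "x \<in> space M"
      then obtain i where i: "x \<in> D i"
        using D(2) by blast
      obtain a b c where abc: "s x < of_nat a" "w x < of_nat b" "g x < of_nat c"
        using fin[of x] by (metis ennreal_Ex_less_of_nat less_top)
      define n where "n = max (max i a) (max b c)"
      have "D i \<subseteq> D n"
        using D(4) by (rule incseqD) (simp add: n_def)
      then have "x \<in> D n"
        using i by blast
      moreover have "s x \<le> of_nat n" "w x \<le> of_nat n" "g x \<le> of_nat n"
        using abc by (auto intro!: order_trans[OF less_imp_le[OF abc(1)] mono]
            order_trans[OF less_imp_le[OF abc(2)] mono] order_trans[OF less_imp_le[OF abc(3)] mono]
            simp: n_def)
      ultimately show "x \<in> (\<Union>n. E n)"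
        by (auto simp: E_def)
    qed (use sets sets.sets_into_space in blast)
  qed (auto simp: E_def)
qed

lemma SUP_indicator_exhaustion:
  assumes "(\<Union>n. E n) = space M" "x \<in> space M"
  shows "(SUP n. indicator (E n) x) = (1 :: ennreal)"
proof (rule antisym)
  obtain n where "x \<in> E n"
    using assms by blast
  then show "1 \<le> (SUP n. indicator (E n) x :: ennreal)"
    by (intro SUP_upper2[of n]) auto
qed (auto intro!: SUP_least simp: indicator_def)

lemma incseq_indicator: "incseq E \<Longrightarrow> incseq (\<lambda>n. indicator (E n) x :: ennreal)"
  by (auto simp: incseq_def indicator_def)

lemma incseq_cumul_density:
  assumes [measurable]: "N \<in> borel_measurable M" "h \<in> borel_measurable M" "\<And>n. E n \<in> sets M"
    and E: "incseq E"
  shows "incseq (\<lambda>n. cumul N (density M (\<lambda>z. h z * indicator (E n) z)) x)"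
proof (rule incseq_SucI)
  fix n
  show "cumul N (density M (\<lambda>z. h z * indicator (E n) z)) x
      \<le> cumul N (density M (\<lambda>z. h z * indicator (E (Suc n)) z)) x"
    using incseq_SucD[OF E, of n]
    by (subst (1 2) cumul_density) (auto intro!: nn_integral_mono split: split_indicator)
qed

lemma SUP_cumul_density:
  assumes [measurable]: "N \<in> borel_measurable M" "h \<in> borel_measurable M" "\<And>n. E n \<in> sets M"
    and E: "incseq E" "(\<Union>n. E n) = space M"
  shows "(SUP n. cumul N (density M (\<lambda>z. h z * indicator (E n) z)) x) = cumul N (density M h) x"
proof -
  have "(SUP n. cumul N (density M (\<lambda>z. h z * indicator (E n) z)) x)
      = (SUP n. \<integral>\<^sup>+z. (if N z < N x then h z else 0) * indicator (E n) z \<partial>M)"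
    by (intro SUP_cong refl, subst cumul_density) (auto intro!: nn_integral_cong)
  also have "\<dots> = (\<integral>\<^sup>+z. (SUP n. (if N z < N x then h z else 0) * indicator (E n) z) \<partial>M)"
    using incseq_indicator[OF E(1)]
    by (intro nn_integral_monotone_convergence_SUP[symmetric])
      (auto simp: incseq_def le_fun_def intro!: mult_left_mono)
  also have "\<dots> = (\<integral>\<^sup>+z. (if N z < N x then h z else 0) \<partial>M)"
    using SUP_indicator_exhaustion[OF E(2)]
    by (intro nn_integral_cong) (simp flip: SUP_mult_left_ennreal)
  finally show ?thesis
    by (simp add: cumul_density)
qed

text \<open>Monotone convergence when the inner distribution functions and the outer weight are
  truncated by the same index.\<close>

lemma SUP_nn_integral_mult_indicator:
  assumes [measurable]: "\<And>n. u n \<in> borel_measurable M" "h \<in> borel_measurable M" "\<And>n. E n \<in> sets M"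
    and E: "incseq E" "(\<Union>n. E n) = space M" and u: "\<And>x. incseq (\<lambda>n. u n x)"
  shows "(\<integral>\<^sup>+x. (SUP n. u n x) * h x \<partial>M) = (SUP n. \<integral>\<^sup>+x. u n x * (h x * indicator (E n) x) \<partial>M)"
proof -
  have inc: "incseq (\<lambda>n. h x * indicator (E n) x)" for x
    using incseq_indicator[OF E(1), of x] unfolding incseq_def by (auto intro!: mult_left_mono)
  have mono: "u m x * (h x * indicator (E m) x) \<le> u n x * (h x * indicator (E n) x)"
    if "m \<le> n" for m n x
    by (rule mult_mono[OF incseqD[OF u that] incseqD[OF inc that]]) simp_all
  have "(SUP n. \<integral>\<^sup>+x. u n x * (h x * indicator (E n) x) \<partial>M)
      = (\<integral>\<^sup>+x. (SUP n. u n x * (h x * indicator (E n) x)) \<partial>M)"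
    by (intro nn_integral_monotone_convergence_SUP[symmetric]) (auto simp: incseq_def le_fun_def mono)
  also have "\<dots> = (\<integral>\<^sup>+x. (SUP n. u n x) * h x \<partial>M)"
    using SUP_indicator_exhaustion[OF E(2)]
    by (intro nn_integral_cong)
      (simp add: SUP_mult_SUP_ennreal[OF u inc, symmetric] SUP_mult_left_ennreal[symmetric])
  finally show ?thesis ..
qed

definition truncated :: "'a measure \<Rightarrow> ('a \<Rightarrow> ennreal) \<Rightarrow> 'a set \<Rightarrow> 'a measure" where
  "truncated M h E = density M (\<lambda>x. h x * indicator E x)"

section \<open>The two-weight inequality on a sigma-finite space\<close>

locale hardy_weights = sigma_finite_measure M for M :: "'a measure" +
  fixes N :: "'a \<Rightarrow> real" and s w :: "'a \<Rightarrow> ennreal" and p q :: real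
  assumes N [measurable]: "N \<in> borel_measurable M"
    and null: "\<And>t. emeasure M {x \<in> space M. N x = t} = 0"
    and s [measurable]: "s \<in> borel_measurable M" and s_fin: "\<And>x. s x < top"
    and w [measurable]: "w \<in> borel_measurable M" and w_fin: "\<And>x. w x < top"
    and q: "1 < q" and pq: "q < p"
begin

text \<open>The quantity \<open>A\<^sub>3\<close> of the theorem, with \<open>s\<close> for
  \<psi>^(1-p'), \<open>w\<close> for \<phi>, and the exponents \<delta>/q and \<delta>/q' expressed
  through p and q.\<close>

definition hardy_const :: ennreal where
  "hardy_const = (\<integral>\<^sup>+x. cumul (\<lambda>x. - N x) (density M w) x epowr (p / (p - q))
     * cumul N (density M s) x epowr ((q - 1) * p / (p - q)) * s x \<partial>M)"

lemma nn_integral_truncated: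
  assumes [measurable]: "h \<in> borel_measurable M" "E \<in> sets M" "f \<in> borel_measurable M"
  shows "(\<integral>\<^sup>+x. f x \<partial>truncated M h E) = (\<integral>\<^sup>+x. f x * (h x * indicator E x) \<partial>M)"
  unfolding truncated_def by (simp add: nn_integral_density mult.commute)

lemma diffuse_finite_truncated:
  assumes [measurable]: "h \<in> borel_measurable M" "E \<in> sets M"
    and "emeasure M E \<noteq> top" "\<And>x. x \<in> E \<Longrightarrow> h x \<le> of_nat n"
  shows "diffuse_finite (truncated M h E) N"
  unfolding truncated_def
proof (rule diffuse_finite_densityI)
  have "(\<integral>\<^sup>+x. h x * indicator E x \<partial>M) \<le> (\<integral>\<^sup>+x. of_nat n * indicator E x \<partial>M)"
    using assms(4) by (intro nn_integral_mono) (auto split: split_indicator)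
  also have "\<dots> = of_nat n * emeasure M E"
    by (simp add: nn_integral_cmult)
  finally show "(\<integral>\<^sup>+x. h x * indicator E x \<partial>M) \<noteq> top"
    using assms(3) by (auto simp: top_unique ennreal_mult_eq_top_iff)
qed (auto simp: null)

lemma measurable_cumul_truncated:
  assumes "diffuse_finite (truncated M h E) N" and [measurable]: "E \<in> sets M" "h \<in> borel_measurable M"
  shows "cumul N (truncated M h E) \<in> borel_measurable M"
    and "cumul (\<lambda>x. - N x) (truncated M h E) \<in> borel_measurable M"
proof -
  interpret diffuse_finite "truncated M h E" N by fact
  show "cumul N (truncated M h E) \<in> borel_measurable M"
      "cumul (\<lambda>x. - N x) (truncated M h E) \<in> borel_measurable M"
    by (intro measurable_cumul sigma_finite_measure_axioms; simp add: truncated_def)+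
qed

text \<open>Used in both directions: each truncated constant is at most the full one, and a bound
  uniform in n passes to the full one.\<close>

lemma hardy_const_eq_SUP:
  assumes E: "incseq E" "(\<Union>n. E n) = space M" and [measurable]: "\<And>n. E n \<in> sets M"
    and pair: "\<And>n. diffuse_finite_pair (truncated M s (E n)) (truncated M w (E n)) N"
  shows "hardy_const = (SUP n. diffuse_finite_pair.hardy_A (truncated M s (E n)) (truncated M w (E n)) N
    (p / (p - q)) ((q - 1) * p / (p - q)))"
proof -
  define \<alpha> where "\<alpha> = p / (p - q)"
  define \<beta> where "\<beta> = (q - 1) * p / (p - q)"
  have exps: "0 < \<alpha>" "0 < \<beta>"
    using q pq by (simp_all add: \<alpha>_def \<beta>_def)
  define u where "u n x = cumul (\<lambda>x. - N x) (truncated M w (E n)) x epowr \<alpha>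
      * cumul N (truncated M s (E n)) x epowr \<beta>" for n x
  have diff: "diffuse_finite (truncated M s (E n)) N" "diffuse_finite (truncated M w (E n)) N" for n
    using pair[of n] by (auto simp: diffuse_finite_pair_def)
  have [measurable]: "u n \<in> borel_measurable M" for n
    unfolding u_def
    by (intro borel_measurable_times_ennreal borel_measurable_epowr measurable_cumul_truncated diff)
      auto
  have inc: "incseq (\<lambda>n. cumul (\<lambda>x. - N x) (truncated M w (E n)) x epowr \<alpha>)"
      "incseq (\<lambda>n. cumul N (truncated M s (E n)) x epowr \<beta>)" for x
    using exps incseq_cumul_density[OF N s _ E(1)]
      incseq_cumul_density[OF borel_measurable_uminus[OF N] w _ E(1)]
    by (auto simp: incseq_def truncated_def intro!: epowr_mono)
  have SUP_u: "(SUP n. u n x) = cumul (\<lambda>x. - N x) (density M w) x epowr \<alpha>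
      * cumul N (density M s) x epowr \<beta>" for x
    unfolding u_def SUP_mult_SUP_ennreal[OF inc, symmetric]
    using exps E by (simp add: epowr_SUP[symmetric] truncated_def SUP_cumul_density)
  have "hardy_const = (\<integral>\<^sup>+x. (SUP n. u n x) * s x \<partial>M)"
    by (simp add: hardy_const_def SUP_u \<alpha>_def \<beta>_def)
  also have "\<dots> = (SUP n. \<integral>\<^sup>+x. u n x * (s x * indicator (E n) x) \<partial>M)"
  proof (rule SUP_nn_integral_mult_indicator)
    show "incseq (\<lambda>n. u n x)" for x
      using inc[of x] unfolding u_def incseq_def by (auto intro!: mult_mono)
  qed (use E in auto)
  also have "\<dots> = (SUP n. diffuse_finite_pair.hardy_A (truncated M s (E n)) (truncated M w (E n)) N \<alpha> \<beta>)"
    unfolding diffuse_finite_pair.hardy_A_def[OF pair]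
    by (simp add: nn_integral_truncated u_def[symmetric])
  finally show ?thesis
    by (simp add: \<alpha>_def \<beta>_def)
qed

lemma diffuse_finite_pair_truncated:
  assumes "E \<in> sets M" "emeasure M E \<noteq> top" "\<And>x. x \<in> E \<Longrightarrow> s x \<le> of_nat n \<and> w x \<le> of_nat n"
  shows "diffuse_finite_pair (truncated M s E) (truncated M w E) N"
  using assms
  by (intro diffuse_finite_pair.intro diffuse_finite_pair_axioms.intro
      diffuse_finite_truncated[of _ _ n]) (auto simp: truncated_def)

lemma density_truncated:
  assumes [measurable]: "g \<in> borel_measurable M" "E \<in> sets M"
  shows "density (truncated M s E) (\<lambda>z. g z * indicator E z)
    = density M (\<lambda>z. (g z * s z) * indicator E z)"
proof -
  have "(\<lambda>z. s z * indicator E z * (g z * indicator E z)) = (\<lambda>z. (g z * s z) * indicator E z)"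
    by (auto simp: fun_eq_iff mult_ac split: split_indicator)
  then show ?thesis
    by (simp add: truncated_def density_density_eq)
qed

text \<open>Weights and g are cut off to the same set. The left sides increase to the full integral,
  while the right sides stay below the untruncated one with a constant independent of n.\<close>

lemma hardy_weighted_sufficient:
  assumes A: "hardy_const < top"
    and [measurable]: "g \<in> borel_measurable M" and g: "\<And>x. g x < top"
  shows "(\<integral>\<^sup>+x. cumul N (density M (\<lambda>z. g z * s z)) x epowr q * w x \<partial>M)
    \<le> ennreal (4 powr q * (4 powr p * (4 / (1 - 2 powr (1 - p)))) powr (q - 1)) *
      (hardy_const epowr ((p - q) / p) * (\<integral>\<^sup>+x. g x epowr p * s x \<partial>M) epowr (q / p))"
proof -
  obtain E where E: "incseq E" "(\<Union>n. E n) = space M" and [measurable]: "\<And>n. E n \<in> sets M"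
    and E_fin: "\<And>n. emeasure M (E n) \<noteq> top"
    and E_le: "\<And>n x. x \<in> E n \<Longrightarrow> s x \<le> of_nat n \<and> w x \<le> of_nat n \<and> g x \<le> of_nat n"
    by (rule exhausting_sets_bounded[of s w g]) (use s w s_fin w_fin assms(2) g in blast)+
  define F where "F n = cumul N (density M (\<lambda>z. (g z * s z) * indicator (E n) z))" for n
  have pair: "diffuse_finite_pair (truncated M s (E n)) (truncated M w (E n)) N" for n
    using E_fin E_le by (intro diffuse_finite_pair_truncated[of _ n]) auto
  have F_eq: "F n = cumul N (density (truncated M s (E n)) (\<lambda>z. g z * indicator (E n) z))" for n
    by (simp add: F_def density_truncated)
  have inc: "incseq (\<lambda>n. F n x epowr q)" for x
    using q incseq_cumul_density[OF N _ _ E(1), of "\<lambda>z. g z * s z" x]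
    by (auto simp: incseq_def F_def intro!: epowr_mono)
  let ?C = "ennreal (4 powr q * (4 powr p * (4 / (1 - 2 powr (1 - p)))) powr (q - 1))"
  let ?R = "?C * (hardy_const epowr ((p - q) / p) * (\<integral>\<^sup>+x. g x epowr p * s x \<partial>M) epowr (q / p))"
  have gE_le: "g x * indicator (E n) x \<le> ennreal (real n)" for n x
    using E_le by (auto simp: ennreal_of_nat_eq_real_of_nat split: split_indicator)
  have F_meas: "F n \<in> borel_measurable M" for n
  proof -
    interpret D: diffuse_finite_pair "truncated M s (E n)" "truncated M w (E n)" N
      by (rule pair)
    interpret \<kappa>: diffuse_finite "density (truncated M s (E n)) (\<lambda>z. g z * indicator (E n) z)" N
      using gE_le by (intro D.\<mu>.diffuse_finite_density[of _ "real n"]) (auto simp: truncated_def)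
    show ?thesis
      unfolding F_eq by (intro measurable_cumul \<kappa>.sigma_finite_measure_axioms) (auto simp: truncated_def)
  qed
  have trunc: "(\<integral>\<^sup>+x. F n x epowr q * (w x * indicator (E n) x) \<partial>M) \<le> ?R" for n
  proof -
    interpret D: diffuse_finite_pair "truncated M s (E n)" "truncated M w (E n)" N
      by (rule pair)
    have "(\<integral>\<^sup>+x. F n x epowr q * (w x * indicator (E n) x) \<partial>M)
        = (\<integral>\<^sup>+x. F n x epowr q \<partial>truncated M w (E n))"
      using F_meas[of n] by (simp add: nn_integral_truncated)
    also have "\<dots> \<le> ?C * (D.hardy_A (p / (p - q)) ((q - 1) * p / (p - q)) epowr ((p - q) / p)
        * (\<integral>\<^sup>+x. (g x * indicator (E n) x) epowr p \<partial>truncated M s (E n)) epowr (q / p))"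
      unfolding F_eq using q pq gE_le
      by (intro D.hardy_sufficient[of _ _ _ "real n"]) (auto simp: truncated_def)
    also have "\<dots> \<le> ?R"
    proof (intro mult_left_mono mult_mono epowr_mono)
      show "D.hardy_A (p / (p - q)) ((q - 1) * p / (p - q)) \<le> hardy_const"
        using hardy_const_eq_SUP[OF E _ pair] by (auto intro!: SUP_upper)
      show "(\<integral>\<^sup>+x. (g x * indicator (E n) x) epowr p \<partial>truncated M s (E n)) \<le> (\<integral>\<^sup>+x. g x epowr p * s x \<partial>M)"
        by (subst nn_integral_truncated) (auto intro!: nn_integral_mono split: split_indicator)
    qed (use q pq in auto)
    finally show ?thesis .
  qed
  have "(\<integral>\<^sup>+x. cumul N (density M (\<lambda>z. g z * s z)) x epowr q * w x \<partial>M)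
      = (\<integral>\<^sup>+x. (SUP n. F n x epowr q) * w x \<partial>M)"
    using q E by (simp add: F_def epowr_SUP[symmetric] SUP_cumul_density)
  also have "\<dots> = (SUP n. \<integral>\<^sup>+x. F n x epowr q * (w x * indicator (E n) x) \<partial>M)"
    using F_meas E inc by (intro SUP_nn_integral_mult_indicator) auto
  also have "\<dots> \<le> ?R"
    using trunc by (rule SUP_least)
  finally show ?thesis .
qed

text \<open>The truncated measures inherit the inequality with the same C, so
  \<open>hardy_necessary\<close> bounds all truncated constants uniformly.\<close>

lemma hardy_weighted_necessary:
  assumes C: "0 < C"
    and ineq: "\<And>g. g \<in> borel_measurable M \<Longrightarrow> (\<And>x. g x < top) \<Longrightarrow>
      (\<integral>\<^sup>+x. cumul N (density M (\<lambda>z. g z * s z)) x epowr q * w x \<partial>M)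
      \<le> ennreal C * (\<integral>\<^sup>+x. g x epowr p * s x \<partial>M) epowr (q / p)"
  shows "hardy_const < top"
proof -
  obtain E where E: "incseq E" "(\<Union>n. E n) = space M" and [measurable]: "\<And>n. E n \<in> sets M"
    and E_fin: "\<And>n. emeasure M (E n) \<noteq> top"
    and E_le: "\<And>n x. x \<in> E n \<Longrightarrow> s x \<le> of_nat n \<and> w x \<le> of_nat n"
    by (rule exhausting_sets_bounded[of s w s]) (use s w s_fin w_fin in blast)+
  have pair: "diffuse_finite_pair (truncated M s (E n)) (truncated M w (E n)) N" for n
    using E_fin E_le by (intro diffuse_finite_pair_truncated[of _ n]) auto
  let ?K = "ennreal (4 powr (p / (p - q) + (q - 1) * p / (p - q) + 1) * C) epowr (p / (p - q))"
  have "diffuse_finite_pair.hardy_A (truncated M s (E n)) (truncated M w (E n)) N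
      (p / (p - q)) ((q - 1) * p / (p - q)) \<le> ?K" for n
  proof -
    interpret D: diffuse_finite_pair "truncated M s (E n)" "truncated M w (E n)" N
      by (rule pair)
    show ?thesis
    proof (rule D.hardy_necessary[OF q pq C])
      fix g :: "'a \<Rightarrow> ennreal" assume "g \<in> borel_measurable (truncated M s (E n))" and g: "\<And>x. g x < top"
      then have [measurable]: "g \<in> borel_measurable M"
        by (simp add: truncated_def)
      \<comment> \<open>Cutting off g instead of the weight \<open>s\<close> produces the same
        density, which makes the assumed inequality applicable.\<close>
      let ?g = "\<lambda>x. g x * indicator (E n) x"
      have "density (truncated M s (E n)) g = density M (\<lambda>z. ?g z * s z)"
        by (simp add: truncated_def density_density_eq mult_ac)
      moreover have "(\<integral>\<^sup>+x. f x \<partial>truncated M w (E n)) \<le> (\<integral>\<^sup>+x. f x * w x \<partial>M)"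
        if [measurable]: "f \<in> borel_measurable M" for f
        by (subst nn_integral_truncated) (auto intro!: nn_integral_mono split: split_indicator)
      moreover have "cumul N (density M (\<lambda>z. ?g z * s z)) \<in> borel_measurable M"
      proof (intro measurable_cumul)
        have "sigma_finite_measure (density M (\<lambda>z. ?g z * s z))"
          using g s_fin by (subst sigma_finite_iff_density_finite)
            (auto simp: ennreal_mult_eq_top_iff split: split_indicator simp flip: less_top)
        then show "sigma_finite_measure (density M (\<lambda>z. ?g z * s z))" .
      qed auto
      ultimately have "(\<integral>\<^sup>+x. cumul N (density (truncated M s (E n)) g) x epowr q \<partial>truncated M w (E n))
          \<le> (\<integral>\<^sup>+x. cumul N (density M (\<lambda>z. ?g z * s z)) x epowr q * w x \<partial>M)"
        by simp
      also have "\<dots> \<le> ennreal C * (\<integral>\<^sup>+x. ?g x epowr p * s x \<partial>M) epowr (q / p)"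
        using g by (intro ineq) (auto split: split_indicator)
      also have "(\<integral>\<^sup>+x. ?g x epowr p * s x \<partial>M) = (\<integral>\<^sup>+x. g x epowr p \<partial>truncated M s (E n))"
        by (subst nn_integral_truncated) (auto intro!: nn_integral_cong split: split_indicator)
      finally show "(\<integral>\<^sup>+x. cumul N (density (truncated M s (E n)) g) x epowr q \<partial>truncated M w (E n))
          \<le> ennreal C * (\<integral>\<^sup>+x. g x epowr p \<partial>truncated M s (E n)) epowr (q / p)" .
    qed
  qed
  then have "hardy_const \<le> ?K"
    unfolding hardy_const_eq_SUP[OF E _ pair, simplified] by (rule SUP_least)
  also have "\<dots> < top"
    by simp
  finally show ?thesis .
qed

end

section \<open>Real-valued weights and functions, with conjugate exponents\<close>

text \<open>The substitution f = r * \<psi>^(1-p') turns f^p * \<psi> into r^p * \<psi>^(1-p'),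
  because (1-p') * p + 1 = 1 - p'. It is a bijection between nonnegative functions since \<psi> is
  positive.\<close>

lemma (in sigma_finite_measure) hardy_real_weights:
  fixes N \<phi> \<psi> :: "'a \<Rightarrow> real" and p q p' q' \<delta> :: real
  assumes N [measurable]: "N \<in> borel_measurable M"
    and null: "\<And>t. emeasure M {x \<in> space M. N x = t} = 0"
    and \<phi> [measurable]: "\<phi> \<in> borel_measurable M"
    and \<psi> [measurable]: "\<psi> \<in> borel_measurable M" and \<psi>_pos: "\<And>x. 0 < \<psi> x"
    and q: "1 < q" and pq: "q < p" and \<delta>: "1 / \<delta> = 1 / q - 1 / p"
    and p': "1 / p + 1 / p' = 1" and q': "1 / q + 1 / q' = 1"
  shows "(\<exists>C>0. \<forall>f\<in>borel_measurable M. (\<forall>x. 0 \<le> f x) \<longrightarrow>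
       (\<integral>\<^sup>+x. (\<integral>\<^sup>+z. (if N z < N x then ennreal (f z) else 0) \<partial>M) epowr q * ennreal (\<phi> x) \<partial>M) epowr (1 / q)
       \<le> ennreal C * (\<integral>\<^sup>+x. ennreal (f x powr p * \<psi> x) \<partial>M) epowr (1 / p))
    \<longleftrightarrow>
    (\<integral>\<^sup>+x. (\<integral>\<^sup>+z. (if N x < N z then ennreal (\<phi> z) else 0) \<partial>M) epowr (\<delta> / q)
         * (\<integral>\<^sup>+z. (if N z < N x then ennreal (\<psi> z powr (1 - p')) else 0) \<partial>M) epowr (\<delta> / q')
         * ennreal (\<psi> x powr (1 - p')) \<partial>M) < \<infinity>"
    (is "?L \<longleftrightarrow> ?R")
proof -
  define s where "s x = ennreal (\<psi> x powr (1 - p'))" for x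
  define w where "w x = ennreal (\<phi> x)" for x
  have [measurable]: "s \<in> borel_measurable M" "w \<in> borel_measurable M"
    unfolding s_def w_def by measurable
  interpret hardy_weights M N s w p q
    by unfold_locales (auto simp: null s_def w_def q pq)
  have "1 / p' = (p - 1) / p" "1 / q' = (q - 1) / q" "1 / \<delta> = (p - q) / (p * q)"
    using p' q' \<delta> q pq by (simp_all add: field_simps)
  \<comment> \<open>Inverting both sides isolates p', q' and \<delta> without a separate argument
    that they are nonzero.\<close>
  then have "inverse (1 / p') = inverse ((p - 1) / p)" "inverse (1 / q') = inverse ((q - 1) / q)"
      "inverse (1 / \<delta>) = inverse ((p - q) / (p * q))"
    by simp_all
  then have conj: "p' = p / (p - 1)" "q' = q / (q - 1)" "\<delta> = p * q / (p - q)"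
    by simp_all
  have exps: "\<delta> / q = p / (p - q)" "\<delta> / q' = (q - 1) * p / (p - q)" "(1 - p') * p + 1 = 1 - p'"
    using q pq by (simp_all add: conj) (simp_all add: field_simps)
  have R: "?R \<longleftrightarrow> hardy_const < top"
    unfolding hardy_const_def exps(1,2) by (simp add: cumul_density s_def w_def cong: if_cong)
  have f_int: "(\<integral>\<^sup>+x. ennreal (f x powr p * \<psi> x) \<partial>M) = (\<integral>\<^sup>+x. ennreal (r x) epowr p * s x \<partial>M)"
    if "\<And>x. f x = r x * \<psi> x powr (1 - p')" "\<And>x. 0 \<le> r x" for f r
  proof (rule nn_integral_cong)
    fix x
    have "f x powr p * \<psi> x = r x powr p * (\<psi> x powr ((1 - p') * p) * \<psi> x powr 1)"
      using that(2)[of x] \<psi>_pos[of x] by (simp add: that(1) powr_mult powr_powr)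
    also have "\<psi> x powr ((1 - p') * p) * \<psi> x powr 1 = \<psi> x powr (1 - p')"
      by (subst powr_add[symmetric]) (simp add: exps(3))
    finally show "ennreal (f x powr p * \<psi> x) = ennreal (r x) epowr p * s x"
      using that(2)[of x] by (simp add: s_def epowr_ennreal ennreal_mult)
  qed
  have f_cumul: "(\<integral>\<^sup>+z. (if N z < N x then ennreal (f z) else 0) \<partial>M)
      = cumul N (density M (\<lambda>z. ennreal (r z) * s z)) x"
    if [measurable]: "r \<in> borel_measurable M"
      and "\<And>x. f x = r x * \<psi> x powr (1 - p')" "\<And>x. 0 \<le> r x" for f r x
    using that by (simp add: cumul_density s_def ennreal_mult cong: if_cong)
  show ?thesis
  proof
    assume ?L
    then obtain C where C: "0 < C" and ineq: "\<And>f. f \<in> borel_measurable M \<Longrightarrow> (\<And>x. 0 \<le> f x) \<Longrightarrow>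
       (\<integral>\<^sup>+x. (\<integral>\<^sup>+z. (if N z < N x then ennreal (f z) else 0) \<partial>M) epowr q * ennreal (\<phi> x) \<partial>M) epowr (1 / q)
       \<le> ennreal C * (\<integral>\<^sup>+x. ennreal (f x powr p * \<psi> x) \<partial>M) epowr (1 / p)"
      by blast
    have "hardy_const < top"
    proof (rule hardy_weighted_necessary)
      show "0 < C powr q"
        using C by simp
      fix g :: "'a \<Rightarrow> ennreal" assume [measurable]: "g \<in> borel_measurable M" and g: "\<And>x. g x < top"
      define r where "r x = enn2real (g x)" for x
      have g_eq: "g = (\<lambda>x. ennreal (r x))"
        using g by (auto simp: r_def)
      define f where "f x = r x * \<psi> x powr (1 - p')" for x
      have [measurable]: "r \<in> borel_measurable M" "f \<in> borel_measurable M"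
        unfolding r_def f_def by measurable
      have pos: "0 \<le> r x" "0 \<le> f x" for x
        by (simp_all add: r_def f_def)
      let ?I = "\<integral>\<^sup>+x. cumul N (density M (\<lambda>z. g z * s z)) x epowr q * w x \<partial>M"
      have "?I epowr (1 / q) \<le> ennreal C * (\<integral>\<^sup>+x. g x epowr p * s x \<partial>M) epowr (1 / p)"
        using ineq[of f] pos by (simp add: f_int[OF f_def] f_cumul[OF _ f_def] g_eq w_def)
      then have "(?I epowr (1 / q)) epowr q
          \<le> (ennreal C * (\<integral>\<^sup>+x. g x epowr p * s x \<partial>M) epowr (1 / p)) epowr q"
        using q by (intro epowr_mono) auto
      then show "?I \<le> ennreal (C powr q) * (\<integral>\<^sup>+x. g x epowr p * s x \<partial>M) epowr (q / p)"
        using q C by (simp add: epowr_mult epowr_epowr epowr_ennreal)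
    qed
    then show ?R
      by (rule R[THEN iffD2])
  next
    assume ?R
    then have A: "hardy_const < top"
      by (rule R[THEN iffD1])
    let ?K = "ennreal (4 powr q * (4 powr p * (4 / (1 - 2 powr (1 - p)))) powr (q - 1))
      * hardy_const epowr ((p - q) / p)"
    have "?K < top"
      using A by (simp add: ennreal_mult_less_top)
    then obtain k where k: "?K = ennreal k" "0 \<le> k"
      by (cases ?K) auto
    show ?L
    \<comment> \<open>k is only known to be nonnegative while a positive constant is demanded, hence
      k + 1.\<close>
    proof (intro exI[of _ "(k + 1) powr (1 / q)"] conjI ballI impI)
      show "0 < (k + 1) powr (1 / q)"
        using k by simp
      fix f :: "'a \<Rightarrow> real" assume [measurable]: "f \<in> borel_measurable M" and f: "\<forall>x. 0 \<le> f x"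
      define r where "r x = f x * \<psi> x powr (p' - 1)" for x
      have [measurable]: "r \<in> borel_measurable M"
        unfolding r_def by measurable
      have r: "0 \<le> r x" "f x = r x * \<psi> x powr (1 - p')" for x
        using f \<psi>_pos[of x] by (simp_all add: r_def mult.assoc flip: powr_add)
      let ?I = "\<integral>\<^sup>+x. cumul N (density M (\<lambda>z. ennreal (r z) * s z)) x epowr q * w x \<partial>M"
      let ?J = "\<integral>\<^sup>+x. ennreal (r x) epowr p * s x \<partial>M"
      have "?I \<le> ennreal k * ?J epowr (q / p)"
        using hardy_weighted_sufficient[OF A, of "\<lambda>x. ennreal (r x)"]
        unfolding k(1)[symmetric] mult.assoc by simp
      also have "\<dots> \<le> ennreal (k + 1) * ?J epowr (q / p)"
        using k by (intro mult_right_mono ennreal_leI) auto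
      finally have "?I epowr (1 / q) \<le> (ennreal (k + 1) * ?J epowr (q / p)) epowr (1 / q)"
        using q by (intro epowr_mono) auto
      also have "\<dots> = ennreal ((k + 1) powr (1 / q)) * ?J epowr (1 / p)"
        using q k(2) by (simp add: epowr_mult epowr_epowr epowr_ennreal del: ennreal_plus)
      finally show "(\<integral>\<^sup>+x. (\<integral>\<^sup>+z. (if N z < N x then ennreal (f z) else 0) \<partial>M) epowr q * ennreal (\<phi> x) \<partial>M) epowr (1 / q)
       \<le> ennreal ((k + 1) powr (1 / q)) * (\<integral>\<^sup>+x. ennreal (f x powr p * \<psi> x) \<partial>M) epowr (1 / p)"
        by (simp add: f_int[OF r(2) r(1)] f_cumul[OF _ r(2) r(1)] w_def)
    qed
  qed
qed

section \<open>Spheres of a homogeneous quasi-norm\<close>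

lemma sigma_finite_completion:
  assumes "sigma_finite_measure M"
  shows "sigma_finite_measure (completion M)"
proof -
  interpret sigma_finite_measure M by fact
  obtain D where D: "countable D" "D \<subseteq> sets M" "\<Union>D = space M" "\<forall>a\<in>D. emeasure M a \<noteq> \<infinity>"
    using sigma_finite_countable by blast
  show ?thesis
  proof
    show "\<exists>A. countable A \<and> A \<subseteq> sets (completion M) \<and> \<Union>A = space (completion M)
        \<and> (\<forall>a\<in>A. emeasure (completion M) a \<noteq> \<infinity>)"
      using D by (intro exI[of _ D]) (auto simp: emeasure_completion main_part_sets)
  qed
qed

text \<open>A strictly positive integrable density gives a finite measure with the same null sets.
  The distribution of \<open>N\<close> under it has at most countably many atoms, so some level in T
  is not one of them.\<close>

lemma (in sigma_finite_measure) ex_null_level: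
  fixes N :: "'a \<Rightarrow> real"
  assumes [measurable]: "N \<in> borel_measurable M" and T: "uncountable T"
  shows "\<exists>t\<in>T. emeasure M {x \<in> space M. N x = t} = 0"
proof -
  obtain h where [measurable]: "h \<in> borel_measurable M" and h_fin: "(\<integral>\<^sup>+x. h x \<partial>M) \<noteq> top"
      and h_pos: "\<And>x. x \<in> space M \<Longrightarrow> 0 < h x"
    using Ex_finite_integrable_function by auto
  have "emeasure (density M h) (space (density M h)) = (\<integral>\<^sup>+x. h x \<partial>M)"
    by (auto simp: emeasure_density intro!: nn_integral_cong)
  with h_fin interpret H: finite_measure "density M h"
    by (intro finite_measureI) simp
  interpret D: finite_measure "distr (density M h) borel N"
    by (rule H.finite_measure_distr) simp
  obtain t where t: "t \<in> T" "measure (distr (density M h) borel N) {t} = 0"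
    using D.countable_support T by (metis (mono_tags, lifting) countable_subset mem_Collect_eq subsetI)
  have vim: "N -` {t} \<inter> space M = {x \<in> space M. N x = t}"
    by auto
  have "emeasure (density M h) {x \<in> space M. N x = t} = 0"
    using t(2) by (simp add: D.emeasure_eq_measure[symmetric] measure_def emeasure_distr vim
        enn2real_eq_0_iff)
  then have "{x \<in> space M. N x = t} \<in> null_sets (density M h)"
    by (auto simp: null_sets_def)
  then have "AE x in M. x \<in> {x \<in> space M. N x = t} \<longrightarrow> h x = 0"
    by (simp add: null_sets_density_iff)
  then have "AE x in M. N x \<noteq> t"
    using AE_space by eventually_elim (use h_pos in force)
  then have "emeasure M {x \<in> space M. N x = t} = 0"
    by (subst (asm) AE_iff_measurable[OF _ refl]) auto
  with t show ?thesis
    by blast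
qed

lemma measurable_quasi_norm:
  assumes "homogeneous_quasi_norm iv A N"
  shows "N \<in> borel_measurable lebesgue"
proof -
  have "N \<in> borel_measurable borel"
    using assms by (intro borel_measurable_continuous_onI) (simp add: homogeneous_quasi_norm_def)
  then show ?thesis
    by (intro measurable_completion) simp
qed

text \<open>All spheres of positive radius are linear images of each other under dilations, and at most
  countably many of them have positive measure.\<close>

lemma null_quasi_norm_level:
  assumes "homogeneous_group mul iv A" and N: "homogeneous_quasi_norm iv A N"
  shows "emeasure lebesgue {x \<in> space lebesgue. N x = t} = 0"
proof -
  interpret homogeneous_group mul iv A by fact
  have pos: "\<And>x. 0 \<le> N x" and zero: "\<And>x. N x = 0 \<longleftrightarrow> x = 0"
    and dil: "\<And>r x. 0 < r \<Longrightarrow> N (dilation A r x) = r * N x"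
    using N by (auto simp: homogeneous_quasi_norm_def)
  have [measurable]: "N \<in> borel_measurable lebesgue"
    using N by (rule measurable_quasi_norm)
  interpret L: sigma_finite_measure "lebesgue :: (real^'n) measure"
    by (rule sigma_finite_completion) (rule sigma_finite_lborel)
  have level: "negligible {x. N x = t} \<longleftrightarrow> emeasure lebesgue {x \<in> space lebesgue. N x = t} = 0" for t
  proof -
    have "{x \<in> space lebesgue. N x = t} \<in> sets lebesgue"
      by measurable
    then show ?thesis
      by (auto simp: negligible_iff_null_sets null_sets_def)
  qed
  have "negligible {x. N x = t}"
  proof (cases "0 < t")
    case True
    have "uncountable {0<..<1::real}"
      by (simp add: uncountable_open_interval)
    then obtain t0 where t0: "0 < t0" "negligible {x. N x = t0}"
      using L.ex_null_level[of N "{0<..<1}"] by (auto simp: level)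
    define D where "D = dilation A (t / t0)"
    have lin: "linear D"
      using dilation_morphism[of "t / t0"] True t0 by (simp add: D_def lie_algebra_morphism_def)
    have N_D: "N (D x) = t / t0 * N x" for x
      using dil[of "t / t0" x] True t0 by (simp add: D_def)
    \<comment> \<open>Injectivity of the dilation is read off from the scaling of the quasi-norm, so
      the operator exponential is never computed.\<close>
    have "x = 0" if "D x = 0" for x
    proof -
      have "N (D x) = 0"
        using that zero[of 0] by simp
      then show ?thesis
        using N_D[of x] True t0 zero[of x] by simp
    qed
    then have "inj D"
      using lin by (simp add: linear_injective_0)
    then have "surj D"
      using lin linear_injective_imp_surjective by blast
    then have sub: "{x. N x = t} \<subseteq> D ` {x. N x = t0}"
    proof (intro subsetI)
      fix y assume "surj D" and y: "y \<in> {x. N x = t}"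
      then obtain x where "y = D x"
        by blast
      moreover have "N x = t0"
        using N_D[of x] True t0 y \<open>y = D x\<close> by (simp add: field_simps)
      ultimately show "y \<in> D ` {x. N x = t0}"
        by blast
    qed
    have "negligible (D ` {x. N x = t0})"
      using t0 lin by (intro negligible_differentiable_image_negligible linear_imp_differentiable_on) auto
    then show ?thesis
      using sub by (rule negligible_subset)
  next
    case False
    have "{x. N x = t} \<subseteq> {0}"
      using False pos zero by (metis (mono_tags, lifting) mem_Collect_eq order.order_iff_strict singletonI subsetI)
    then show ?thesis
      by (rule negligible_subset[OF negligible_sing])
  qed
  then show ?thesis
    by (simp add: level)
qed

section \<open>The two equivalences on the homogeneous group\<close>

theorem theorem3p3:
  fixes mul :: "real^'n \<Rightarrow> real^'n \<Rightarrow> real^'n" and iv A :: "real^'n \<Rightarrow> real^'n"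
    and N :: "real^'n \<Rightarrow> real" and Q :: real
    and \<phi>\<^sub>3 \<phi>\<^sub>4 \<psi>\<^sub>3 \<psi>\<^sub>4 :: "real^'n \<Rightarrow> real"
    and p q p' q' \<delta> :: real
  assumes "homogeneous_group mul iv A"
    and "homogeneous_dim A = Q"
    and "homogeneous_quasi_norm iv A N"
    and "\<phi>\<^sub>3 \<in> borel_measurable lebesgue" and "\<And>x. 0 < \<phi>\<^sub>3 x"
    and "\<phi>\<^sub>4 \<in> borel_measurable lebesgue" and "\<And>x. 0 < \<phi>\<^sub>4 x"
    and "\<psi>\<^sub>3 \<in> borel_measurable lebesgue" and "\<And>x. 0 < \<psi>\<^sub>3 x"
    and "\<psi>\<^sub>4 \<in> borel_measurable lebesgue" and "\<And>x. 0 < \<psi>\<^sub>4 x"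
    and "1 < q" and "q < p"
    and "1 / \<delta> = 1 / q - 1 / p"
    and "1 / p + 1 / p' = 1" and "1 / q + 1 / q' = 1"
  defines "B \<equiv> quasi_ball mul iv N"
  shows
    "((\<exists>C\<^sub>1>0. \<forall>f\<in>borel_measurable lebesgue. (\<forall>x. 0 \<le> f x) \<longrightarrow>
         (\<integral>\<^sup>+x. (\<integral>\<^sup>+z\<in>B 0 (N x). ennreal (f z) \<partial>lebesgue) epowr q * ennreal (\<phi>\<^sub>3 x) \<partial>lebesgue) epowr (1 / q)
         \<le> ennreal C\<^sub>1 * (\<integral>\<^sup>+x. ennreal (f x powr p * \<psi>\<^sub>3 x) \<partial>lebesgue) epowr (1 / p))
      \<longleftrightarrow>
      (\<integral>\<^sup>+x. (\<integral>\<^sup>+z\<in>UNIV - B 0 (N x). ennreal (\<phi>\<^sub>3 z) \<partial>lebesgue) epowr (\<delta> / q)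
           * (\<integral>\<^sup>+z\<in>B 0 (N x). ennreal (\<psi>\<^sub>3 z powr (1 - p')) \<partial>lebesgue) epowr (\<delta> / q')
           * ennreal (\<psi>\<^sub>3 x powr (1 - p')) \<partial>lebesgue) < \<infinity>)
     \<and>
     ((\<exists>C\<^sub>2>0. \<forall>f\<in>borel_measurable lebesgue. (\<forall>x. 0 \<le> f x) \<longrightarrow>
         (\<integral>\<^sup>+x. (\<integral>\<^sup>+z\<in>UNIV - B 0 (N x). ennreal (f z) \<partial>lebesgue) epowr q * ennreal (\<phi>\<^sub>4 x) \<partial>lebesgue) epowr (1 / q)
         \<le> ennreal C\<^sub>2 * (\<integral>\<^sup>+x. ennreal (f x powr p * \<psi>\<^sub>4 x) \<partial>lebesgue) epowr (1 / p))
      \<longleftrightarrow>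
      (\<integral>\<^sup>+x. (\<integral>\<^sup>+z\<in>B 0 (N x). ennreal (\<phi>\<^sub>4 z) \<partial>lebesgue) epowr (\<delta> / q)
           * (\<integral>\<^sup>+z\<in>UNIV - B 0 (N x). ennreal (\<psi>\<^sub>4 z powr (1 - p')) \<partial>lebesgue) epowr (\<delta> / q')
           * ennreal (\<psi>\<^sub>4 x powr (1 - p')) \<partial>lebesgue) < \<infinity>)"
proof -
  interpret homogeneous_group mul iv A by fact
  interpret L: sigma_finite_measure "lebesgue :: (real^'n) measure"
    by (rule sigma_finite_completion) (rule sigma_finite_lborel)
  have null: "emeasure lebesgue {x \<in> space lebesgue. N x = t} = 0" for t
    by (rule null_quasi_norm_level) fact+
  have N [measurable]: "N \<in> borel_measurable lebesgue"
    using assms(3) by (rule measurable_quasi_norm)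
  have mem_B: "z \<in> B 0 r \<longleftrightarrow> N z < r" for z r
    using left_neutral inverse_neutral by (simp add: B_def quasi_ball_def)
  have inside: "(\<integral>\<^sup>+z\<in>B 0 (N x). h z \<partial>lebesgue) = (\<integral>\<^sup>+z. (if N z < N x then h z else 0) \<partial>lebesgue)"
    for h x
    by (intro nn_integral_cong) (simp add: mem_B indicator_def)
  \<comment> \<open>The complement of the ball also contains the sphere through x; removing this
    null set leaves the strict inequality that \<open>cumul\<close> uses for
    \<open>- N\<close>.\<close>
  have outside: "(\<integral>\<^sup>+z\<in>UNIV - B 0 (N x). h z \<partial>lebesgue)
      = (\<integral>\<^sup>+z. (if N x < N z then h z else 0) \<partial>lebesgue)" for h x
  proof (rule nn_integral_cong_AE)
    have "AE z in lebesgue. N z \<noteq> N x"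
    proof (rule AE_I[OF _ null[of "N x"]])
      show "{z \<in> space lebesgue. N z = N x} \<in> sets lebesgue"
        by measurable
    qed auto
    then show "AE z in lebesgue. h z * indicator (UNIV - B 0 (N x)) z = (if N x < N z then h z else 0)"
      by eventually_elim (auto simp: mem_B indicator_def)
  qed
  have null': "emeasure lebesgue {x \<in> space lebesgue. - N x = t} = 0" for t
  proof -
    have "{x \<in> space lebesgue. - N x = t} = {x \<in> space lebesgue. N x = - t}"
      by auto
    then show ?thesis
      using null[of "- t"] by simp
  qed
  show ?thesis
    \<comment> \<open>The second equivalence is the first one for the rank function
      \<open>- N\<close>, under which inside and outside change places.\<close>
    unfolding inside outside
    using L.hardy_real_weights[OF N null assms(4) assms(8,9) assms(12-16)]
      L.hardy_real_weights[OF borel_measurable_uminus[OF N] null' assms(6) assms(10,11) assms(12-16)]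
    unfolding neg_less_iff_less by (rule conjI)
qed

end
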